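(* For a suitable choice of $\delta\ge 1$ (namely $\delta = 2.0543$), Algorithm $A3(\delta)$ is a $2.17$-approximation for the Squared Metric Facility Location Problem.
   Context: Facility Location Problem: given finite disjoint sets $C$ (cities), $F$ (facilities), non-negative costs $c_{ij}$ and $f_i$, find $F'\subseteq F$ minimizing $\sum_{i\in F'}f_i+\sum_{j\in C}\min_{i\in F'}c_{ij}$. Squared metric instances satisfy $\sqrt{c_{ij}}\le \sqrt{c_{ij'}}+\sqrt{c_{i'j'}}+\sqrt{c_{i'j}}$ for all facilities $i,i'$ and cities $j,j'$. Algorithm $A2$: initially all facilities are unopened, all cities unconnected ($U:=C$), each city $j$ has budget $\alpha_j=0$. At each moment, an unconnected city $j$ offers $\max(\alpha_j-c_{ij},0)$ to each unopened facility $i$, and a city $j$ connected to facility $i'$ offers $\max(c_{i'j}-c_{ij},0)$ to $i$. While $U\neq\emptyset$, the budgets of all unconnected cities increase continuously at the same rate until: (a) for some unconnected $j$ and open $i$, $\alpha_j=c_{ij}$: connect $j$ to $i$ and remove $j$ from $U$; or (b) for some unopened $i$ the total offer received equals $f_i$: open $i$, connect to $i$ every city with a positive offer to $i$ (reconnecting if already connected), and remove the connected cities from $U$. Algorithm $A3(\delta)$: (1) multiply all facility costs by $\delta$ and run $A2$ on the scaled instance; (2) greedy augmentation with original costs: while some unopened facility would reduce the total cost if opened, compute for each unopened $i$ its gain $g_i$ (decrease in total cost if $i$ is opened) and open a facility maximizing $g_i/f_i$. *)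

theory Defs
  imports Complex_Main
begin

text \<open>Facility location instance: cities C :: 'c set, facilities F :: 'f set
  (disjointness is automatic via distinct types), facility costs f :: 'f \<Rightarrow> real,
  connection costs c :: 'f \<Rightarrow> 'c \<Rightarrow> real (c i j = cost of serving city j by facility i).\<close>

definition fl_cost :: "('f \<Rightarrow> real) \<Rightarrow> ('f \<Rightarrow> 'c \<Rightarrow> real) \<Rightarrow> 'c set \<Rightarrow> 'f set \<Rightarrow> real" where
  "fl_cost f c C S = (\<Sum>i\<in>S. f i) + (\<Sum>j\<in>C. Min ((\<lambda>i. c i j) ` S))"

definition squared_metric :: "'c set \<Rightarrow> 'f set \<Rightarrow> ('f \<Rightarrow> 'c \<Rightarrow> real) \<Rightarrow> bool" where
  "squared_metric C F c \<longleftrightarrow>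
     (\<forall>i\<in>F. \<forall>i'\<in>F. \<forall>j\<in>C. \<forall>j'\<in>C.
        sqrt (c i j) \<le> sqrt (c i j') + sqrt (c i' j') + sqrt (c i' j))"

text \<open>State: (t, Op, conn), where t is the current time (= common budget \<alpha>_j of all
  unconnected cities), Op the set of open facilities, conn j = Some i if city j is
  connected to facility i, None if unconnected.\<close>

type_synonym ('f,'c) a2_state = "real \<times> 'f set \<times> ('c \<Rightarrow> 'f option)"

definition a2_offer :: "('f \<Rightarrow> 'c \<Rightarrow> real) \<Rightarrow> ('c \<Rightarrow> 'f option) \<Rightarrow> real \<Rightarrow> 'f \<Rightarrow> 'c \<Rightarrow> real" where
  "a2_offer c conn t i j =
     (case conn j of None \<Rightarrow> max (t - c i j) 0
                   | Some i' \<Rightarrow> max (c i' j - c i j) 0)"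

definition a2_total_offer :: "'c set \<Rightarrow> ('f \<Rightarrow> 'c \<Rightarrow> real) \<Rightarrow> ('c \<Rightarrow> 'f option) \<Rightarrow> real \<Rightarrow> 'f \<Rightarrow> real" where
  "a2_total_offer C c conn t i = (\<Sum>j\<in>C. a2_offer c conn t i j)"

definition a2_no_event :: "'c set \<Rightarrow> 'f set \<Rightarrow> ('f \<Rightarrow> real) \<Rightarrow> ('f \<Rightarrow> 'c \<Rightarrow> real)
    \<Rightarrow> 'f set \<Rightarrow> ('c \<Rightarrow> 'f option) \<Rightarrow> real \<Rightarrow> bool" where
  "a2_no_event C F f c Op conn s \<longleftrightarrow>
     (\<forall>j\<in>C. conn j = None \<longrightarrow> (\<forall>i\<in>Op. s \<noteq> c i j)) \<and>
     (\<forall>i\<in>F - Op. a2_total_offer C c conn s i \<noteq> f i)"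

definition a2_step :: "'c set \<Rightarrow> 'f set \<Rightarrow> ('f \<Rightarrow> real) \<Rightarrow> ('f \<Rightarrow> 'c \<Rightarrow> real)
    \<Rightarrow> ('f,'c) a2_state \<Rightarrow> ('f,'c) a2_state \<Rightarrow> bool" where
  "a2_step C F f c st st' \<longleftrightarrow>
     (case st of (t, Op, conn) \<Rightarrow> case st' of (t', Op', conn') \<Rightarrow>
        {j\<in>C. conn j = None} \<noteq> {} \<and> t \<le> t' \<and>
        (\<forall>s. t \<le> s \<and> s < t' \<longrightarrow> a2_no_event C F f c Op conn s) \<and>
        ((\<exists>j\<in>C. \<exists>i\<in>Op. conn j = None \<and> t' = c i j \<and> Op' = Op \<and> conn' = conn(j := Some i)) \<or>
         (\<exists>i\<in>F - Op. a2_total_offer C c conn t' i = f i \<and> Op' = insert i Op \<and>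
            conn' = (\<lambda>j. if j \<in> C \<and> a2_offer c conn t' i j > 0 then Some i else conn j))))"

definition a2_output :: "'c set \<Rightarrow> 'f set \<Rightarrow> ('f \<Rightarrow> real) \<Rightarrow> ('f \<Rightarrow> 'c \<Rightarrow> real) \<Rightarrow> 'f set \<Rightarrow> bool" where
  "a2_output C F f c Op \<longleftrightarrow>
     (\<exists>t conn. (a2_step C F f c)\<^sup>*\<^sup>* (0, {}, \<lambda>_. None) (t, Op, conn) \<and>
               {j\<in>C. conn j = None} = {})"

definition gain :: "('f \<Rightarrow> real) \<Rightarrow> ('f \<Rightarrow> 'c \<Rightarrow> real) \<Rightarrow> 'c set \<Rightarrow> 'f set \<Rightarrow> 'f \<Rightarrow> real" where
  "gain f c C S i = fl_cost f c C S - fl_cost f c C (insert i S)"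

text \<open>One augmentation step: some unopened facility has positive gain, and a facility
  maximizing g_i/f_i is opened. The ratio comparison is cross-multiplied so that
  f_i = 0 (with g_i > 0) counts as ratio +\<infinity>.\<close>
definition greedy_step :: "'c set \<Rightarrow> 'f set \<Rightarrow> ('f \<Rightarrow> real) \<Rightarrow> ('f \<Rightarrow> 'c \<Rightarrow> real)
    \<Rightarrow> 'f set \<Rightarrow> 'f set \<Rightarrow> bool" where
  "greedy_step C F f c S S' \<longleftrightarrow>
     (\<exists>i\<in>F - S. gain f c C S i > 0 \<and>
        (\<forall>i'\<in>F - S. gain f c C S i' > 0 \<longrightarrow> gain f c C S i' * f i \<le> gain f c C S i * f i') \<and>
        S' = insert i S)"

definition greedy_final :: "'c set \<Rightarrow> 'f set \<Rightarrow> ('f \<Rightarrow> real) \<Rightarrow> ('f \<Rightarrow> 'c \<Rightarrow> real) \<Rightarrow> 'f set \<Rightarrow> bool" where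
  "greedy_final C F f c S \<longleftrightarrow> (\<forall>i\<in>F - S. gain f c C S i \<le> 0)"

definition a3_output :: "real \<Rightarrow> 'c set \<Rightarrow> 'f set \<Rightarrow> ('f \<Rightarrow> real) \<Rightarrow> ('f \<Rightarrow> 'c \<Rightarrow> real) \<Rightarrow> 'f set \<Rightarrow> bool" where
  "a3_output \<delta> C F f c S \<longleftrightarrow>
     (\<exists>Op. a2_output C F (\<lambda>i. \<delta> * f i) c Op \<and>
          (greedy_step C F f c)\<^sup>*\<^sup>* Op S \<and> greedy_final C F f c S)"

end

theory Submission
  imports Defs "HOL-Analysis.Harmonic_Numbers"
begin

text \<open>
  After scaling, the cost of a solution of A2 is at most the total budget, so it suffices to bound
  the budgets of the cities served by one optimal facility (a star) by
  $1.45\,f + 3.4035\,\sum_j d_j$. The offers to the facility never exceed its cost, and a city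
  that is connected later keeps, by the squared metric inequality, all earlier cities expensive:
  $\sqrt{\alpha_m} \le \sqrt{r_j} + \sqrt{d_j} + \sqrt{d_m}$. Linearising both inequalities by
  Cauchy-Schwarz turns this into a linear program, which is bounded by an explicit dual solution
  with density $(1-a(x))/(1-x)$ for a step function $a$; the dual value is estimated by
  logarithms of eleven rational numbers. The greedy phase pays $\ln\delta$ for the optimal
  facilities, and $1.45 + \ln\delta \le 2.17$, $1 + 2.4035/\delta \le 2.17$.
\<close>

section \<open>The star inequality\<close>

text \<open>Measured from the city connected last, the density is \<open>(1 - a) / y\<close>, which
  is not integrable at \<open>0\<close>. Its total has to stay below \<open>1.45\<close>, the factor
  of the opening cost, so \<open>a = 1\<close> near \<open>0\<close>: there the metric inequality
  alone pays for the budgets. The difficulty is that the \<open>u\<close> variables couple all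
  cities. They are running maxima, hence monotone, and their coefficients in the dual change sign
  only once; therefore it is enough that these coefficients have a nonnegative sum, and this sum is
  the main quantity to be estimated. The constants leave almost no room: 2.0543 is just below
  \<open>exp 0.72\<close>, and 3.4035 is \<open>1 + 1.17 * \<delta>\<close> rounded down.\<close>

text \<open>With \<open>u = (sqrt \<alpha> - sqrt d)\<^sup>2\<close> for a later city, this bounds from below the offer of a
  connected city at distance \<open>d\<close> from the facility.\<close>

definition reconn :: "real \<Rightarrow> real \<Rightarrow> real" where
  "reconn u d = max 0 ((max 0 (sqrt u - sqrt d))\<^sup>2 - d)"

lemma reconn_nonneg: "0 \<le> reconn u d"
  by (simp add: reconn_def)

text \<open>Cauchy-Schwarz; equality holds for \<open>sqrt u = \<theta> * sqrt d\<close>, which also is the equality case of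
  the next lemma. The optimal dual solution uses the same \<open>\<theta>\<close> for both.\<close>

lemma reconn_ge:
  assumes "1 \<le> \<theta>" "0 \<le> u" "0 \<le> d"
  shows "(\<theta> - 1) / \<theta> * u - \<theta> * d \<le> reconn u d"
proof -
  define x s where "x = sqrt u" and "s = sqrt d"
  have u: "u = x\<^sup>2" and d: "d = s\<^sup>2" and x: "0 \<le> x" and s: "0 \<le> s"
    using assms by (auto simp: x_def s_def)
  have "(\<theta> - 1) / \<theta> * x\<^sup>2 - (\<theta> - 1) * s\<^sup>2 \<le> (max 0 (x - s))\<^sup>2"
  proof (cases "s \<le> x")
    case True
    have "0 \<le> (x - \<theta> * s)\<^sup>2 / \<theta>" using assms by simp
    also have "\<dots> = (x - s)\<^sup>2 - ((\<theta> - 1) / \<theta> * x\<^sup>2 - (\<theta> - 1) * s\<^sup>2)"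
      using assms by (simp add: field_simps power2_eq_square)
    finally show ?thesis using True by simp
  next
    case False
    have "(\<theta> - 1) / \<theta> * x\<^sup>2 \<le> (\<theta> - 1) * s\<^sup>2"
    proof (rule mult_mono)
      show "(\<theta> - 1) / \<theta> \<le> \<theta> - 1" using assms divide_left_mono[of 1 \<theta> "\<theta> - 1"] by simp
      show "x\<^sup>2 \<le> s\<^sup>2" using False x by (intro power_mono) auto
    qed (use assms in auto)
    thus ?thesis using False by simp
  qed
  thus ?thesis unfolding reconn_def u d using x s by (simp add: algebra_simps)
qed

text \<open>Squaring and \<open>(x + s)\<^sup>2 \<le> (1 + 1 / \<theta>) * x\<^sup>2 + (1 +
  \<theta>) * s\<^sup>2\<close>, whose defect is a multiple of
  \<open>(x - \<theta> * s)\<^sup>2\<close>.\<close>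

lemma budget_le:
  assumes "0 < \<theta>" "sqrt \<alpha> \<le> sqrt u + sqrt d" "0 \<le> \<alpha>" "0 \<le> u" "0 \<le> d"
  shows "\<theta> / (1 + \<theta>) * \<alpha> - \<theta> * d \<le> u"
proof -
  define x s where "x = sqrt u" and "s = sqrt d"
  have u: "u = x\<^sup>2" and d: "d = s\<^sup>2"
    using assms by (auto simp: x_def s_def)
  have "\<alpha> \<le> (x + s)\<^sup>2"
    using assms(2,3) by (metis d power_mono real_sqrt_ge_zero real_sqrt_pow2 s_def x_def)
  hence "\<theta> / (1 + \<theta>) * \<alpha> \<le> \<theta> / (1 + \<theta>) * (x + s)\<^sup>2"
    using assms by (intro mult_left_mono) auto
  moreover have "0 \<le> (x - \<theta> * s)\<^sup>2 / (1 + \<theta>)" using assms by simp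
  moreover have "(x - \<theta> * s)\<^sup>2 / (1 + \<theta>) = x\<^sup>2 - (\<theta> / (1 + \<theta>) * (x + s)\<^sup>2 - \<theta> * s\<^sup>2)"
    using assms by (simp add: field_simps power2_eq_square)
  ultimately show ?thesis by (simp add: u d)
qed

text \<open>Index \<open>0\<close> is the city connected last; at the time city \<open>r\<close> gets connected, the cities \<open>j \<le> r\<close>
  are still unconnected. The values \<open>u r\<close> stand for the maximum of
  \<open>(max 0 (sqrt \<alpha> - sqrt d))\<^sup>2\<close> over the cities connected no earlier than \<open>r\<close>.\<close>

definition star_feasible :: "nat \<Rightarrow> (nat \<Rightarrow> real) \<Rightarrow> (nat \<Rightarrow> real) \<Rightarrow> (nat \<Rightarrow> real) \<Rightarrow> real \<Rightarrow> bool" where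
  "star_feasible n \<alpha> d u f \<longleftrightarrow>
     (\<forall>r<n. 0 \<le> \<alpha> r \<and> 0 \<le> d r \<and> 0 \<le> u r \<and> sqrt (\<alpha> r) \<le> sqrt (u r) + sqrt (d r) \<and>
        reconn (u r) (d r) \<le> max 0 (\<alpha> r - d r) \<and>
        (\<Sum>j<n. if j \<le> r then max 0 (\<alpha> r - d j) else reconn (u r) (d j)) \<le> f) \<and>
     (\<forall>r s. r \<le> s \<longrightarrow> s < n \<longrightarrow> u r \<le> u s)"

text \<open>Weak duality: \<open>\<omega>\<close> and \<open>z\<close> are the multipliers of the offer constraints and of the linearised
  inequality \<open>sqrt \<alpha> \<le> sqrt u + sqrt d\<close>.\<close>

lemma weighted_star:
  fixes \<omega> z \<tau> \<theta> p s :: "nat \<Rightarrow> real"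
  assumes feas: "star_feasible n \<alpha> d u f"
    and w0: "\<And>r. r < n \<Longrightarrow> 0 \<le> \<omega> r" and z0: "\<And>r. r < n \<Longrightarrow> 0 \<le> z r"
    and a1: "\<And>r. r < n \<Longrightarrow> 1 \<le> \<omega> r * (real r + 1) + z r * \<tau> r"
    and bl: "\<And>r. r < n \<Longrightarrow> \<tau> r * \<alpha> r - \<theta> r * d r \<le> u r"
    and ps: "\<And>r j. r < n \<Longrightarrow> j < n \<Longrightarrow> p j * u r - s j * d j \<le> reconn (u r) (d j)"
    and dc: "\<And>j. j < n \<Longrightarrow> (\<Sum>i\<in>{j..<n}. \<omega> i) + s j * (\<Sum>i<j. \<omega> i) + z j * \<theta> j \<le> g"
    and uc: "0 \<le> (\<Sum>r<n. u r * (\<omega> r * (\<Sum>j\<in>{r<..<n}. p j) - z r))"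
  shows "(\<Sum>r<n. \<alpha> r) \<le> (\<Sum>r<n. \<omega> r) * f + g * (\<Sum>r<n. d r)"
proof -
  have pos: "0 \<le> \<alpha> r" "0 \<le> d r" "0 \<le> u r" if "r < n" for r
    using feas that by (auto simp: star_feasible_def)
  \<comment> \<open>Coefficient of \<open>d j\<close> in the linearised offer constraint of
    \<open>r\<close>: \<open>1\<close> for a city still unconnected, \<open>s j\<close> for a
    reconnection offer.\<close>
  define e where "e r j = (if j \<le> r then 1 else s j)" for r j :: nat
  have key: "\<omega> r * ((real r + 1) * \<alpha> r + u r * (\<Sum>j\<in>{r<..<n}. p j) - (\<Sum>j<n. e r j * d j)) \<le> \<omega> r * f"
    if r: "r < n" for r
  proof (rule mult_left_mono[OF _ w0[OF r]])
    have split: "{..<n} = {..r} \<union> {r<..<n}" "{..r} \<inter> {r<..<n} = {}" using r by auto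
    have "(real r + 1) * \<alpha> r + u r * (\<Sum>j\<in>{r<..<n}. p j) - (\<Sum>j<n. e r j * d j)
        = (\<Sum>j\<in>{..r}. \<alpha> r - d j) + (\<Sum>j\<in>{r<..<n}. p j * u r - s j * d j)"
      unfolding split(1)
      by (subst sum.union_disjoint) (auto simp: e_def sum_subtractf sum_distrib_left mult.commute algebra_simps)
    also have "\<dots> \<le> (\<Sum>j\<in>{..r}. max 0 (\<alpha> r - d j)) + (\<Sum>j\<in>{r<..<n}. reconn (u r) (d j))"
      using ps[OF r] by (intro add_mono sum_mono) auto
    also have "\<dots> = (\<Sum>j<n. if j \<le> r then max 0 (\<alpha> r - d j) else reconn (u r) (d j))"
      unfolding split(1) by (subst sum.union_disjoint) auto
    also have "\<dots> \<le> f" using feas r by (simp add: star_feasible_def)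
    finally show "(real r + 1) * \<alpha> r + u r * (\<Sum>j\<in>{r<..<n}. p j) - (\<Sum>j<n. e r j * d j) \<le> f" .
  qed
  \<comment> \<open>All constraints are added with their multipliers. Collecting terms,
    \<open>a1\<close> controls the coefficients of \<alpha>, \<open>uc\<close> those of
    \<open>u\<close>, and \<open>dc\<close> those of \<open>d\<close>.\<close>
  have "(\<Sum>r<n. \<omega> r * ((real r + 1) * \<alpha> r + u r * (\<Sum>j\<in>{r<..<n}. p j) - (\<Sum>j<n. e r j * d j))
           + z r * (\<tau> r * \<alpha> r - \<theta> r * d r))
      \<le> (\<Sum>r<n. \<omega> r * f + z r * u r)"
    using key bl z0 by (intro sum_mono add_mono) (auto intro: mult_left_mono)
  hence A: "(\<Sum>r<n. (\<omega> r * (real r + 1) + z r * \<tau> r) * \<alpha> r)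
        + (\<Sum>r<n. u r * (\<omega> r * (\<Sum>j\<in>{r<..<n}. p j) - z r))
      \<le> (\<Sum>r<n. \<omega> r) * f + ((\<Sum>r<n. \<Sum>j<n. \<omega> r * (e r j * d j)) + (\<Sum>r<n. z r * \<theta> r * d r))"
    by (simp add: sum.distrib sum_subtractf algebra_simps sum_distrib_left sum_distrib_right)
  have "(\<Sum>r<n. \<alpha> r) \<le> (\<Sum>r<n. (\<omega> r * (real r + 1) + z r * \<tau> r) * \<alpha> r)"
    using a1 pos mult_right_mono[OF a1 pos(1)] by (intro sum_mono) auto
  moreover have "(\<Sum>r<n. \<Sum>j<n. \<omega> r * (e r j * d j)) + (\<Sum>r<n. z r * \<theta> r * d r)
      = (\<Sum>j<n. d j * ((\<Sum>i\<in>{j..<n}. \<omega> i) + s j * (\<Sum>i<j. \<omega> i) + z j * \<theta> j))"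
  proof -
    have "(\<Sum>r<n. \<omega> r * (e r j * d j)) = d j * ((\<Sum>i\<in>{j..<n}. \<omega> i) + s j * (\<Sum>i<j. \<omega> i))"
      if "j < n" for j
    proof -
      have split: "{..<n} = {j..<n} \<union> {..<j}" "{j..<n} \<inter> {..<j} = {}" using that by auto
      show ?thesis unfolding split(1)
        by (subst sum.union_disjoint)
          (auto simp: e_def algebra_simps sum_distrib_left sum_distrib_right)
    qed
    thus ?thesis
      by (subst sum.swap) (simp add: sum.distrib algebra_simps)
  qed
  moreover have "\<dots> \<le> (\<Sum>j<n. d j * g)"
    using dc pos by (intro sum_mono mult_left_mono) auto
  ultimately show ?thesis using A uc by (simp add: sum_distrib_left mult.commute)
qed

section \<open>Sums over a block compared with integrals\<close>

text \<open>The integral of \<open>ln x - ln p\<close> over \<open>[p, q]\<close> is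
  \<open>q * (ln q - ln p) - (q - p)\<close>. A left Riemann sum of this increasing function loses
  at most one final value, hence the factor \<open>q - 1\<close>.\<close>

lemma sum_ln_ge:
  fixes p q :: nat
  assumes "0 < p" "p \<le> q"
  shows "(real q - 1) * (ln (real q) - ln (real p)) - (real q - real p)
    \<le> (\<Sum>r\<in>{p..<q}. ln (real r) - ln (real p))"
  using assms(2)
proof (induction q rule: dec_induct)
  case (step m)
  have "ln (real (Suc m)) - ln (real m) = ln (1 + 1 / real m)"
  proof -
    have "1 + 1 / real m = real (Suc m) / real m" using step.hyps assms(1) by (simp add: field_simps)
    thus ?thesis using step.hyps assms(1) ln_div[of "real (Suc m)" "real m"] by simp
  qed
  also have "\<dots> \<le> 1 / real m" by (rule ln_add_one_self_le_self) auto
  finally have "real m * (ln (real (Suc m)) - ln (real m)) \<le> real m * (1 / real m)"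
    by (intro mult_left_mono) auto
  hence "real m * (ln (real (Suc m)) - ln (real m)) \<le> 1"
    using step assms by simp
  thus ?case using step.IH step.hyps by (simp add: algebra_simps)
qed simp

text \<open>The right-hand side is the chord of the convex function \<open>1 / x\<close> through
  \<open>x2\<close> and \<open>x1\<close>.\<close>

lemma inverse_secant:
  fixes x :: real
  assumes "0 < x2" "x2 \<le> x" "x \<le> x1"
  shows "1 / x \<le> (x1 + x2 - x) / (x1 * x2)"
proof -
  have "0 \<le> (x1 - x) * (x - x2)" using assms by simp
  hence "x1 * x2 \<le> x * (x1 + x2 - x)" by (simp add: algebra_simps)
  thus ?thesis using assms by (simp add: field_simps)
qed

text \<open>The chord turns a sum of reciprocals into a sum of logarithms, to which
  \<open>sum_ln_ge\<close> applies. Everything scales with \<open>h\<close> except the last term on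
  the left, the discretisation error.\<close>

lemma block_sum_ge:
  fixes P Q h :: nat and k b C x0 x1 x2 l :: real
  assumes PQ: "0 < P" "P \<le> Q" and h: "0 < h" and k: "0 \<le> k" and b: "0 \<le> b"
    and X: "\<And>r. r \<in> {P*h..<Q*h} \<Longrightarrow> X r = x0 + b * (ln (real r) - ln (real (P*h)))"
    and x: "0 < x2" "x2 \<le> x0" "x0 + b * ln (real Q / real P) \<le> x1"
    and l: "l \<le> ln (real Q / real P)"
  shows "real h * (C * real (Q - P) - k / (x1 * x2) *
            ((x1 + x2) * real (Q - P) - (x2 * real (Q - P) + b * (real Q * l - real (Q - P)))))
          - k / (x1 * x2) * (b * ln (real Q / real P))
     \<le> (\<Sum>r\<in>{P*h..<Q*h}. C - k / X r)"
proof -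
  define L where "L = ln (real Q / real P)"
  have lnL: "ln (real (Q*h)) - ln (real (P*h)) = L"
    using PQ h by (simp add: L_def ln_div ln_mult)
  have L0: "0 \<le> L" using PQ by (simp add: L_def)
  have bL: "0 \<le> b * L" using b L0 by simp
  have x1: "0 < x1" using x bL unfolding L_def[symmetric] by linarith
  define K where "K = k / (x1 * x2)"
  have K: "0 \<le> K" using k x x1 by (simp add: K_def)
  have Xr: "x2 \<le> X r" "X r \<le> x1" if r: "r \<in> {P*h..<Q*h}" for r
  proof -
    have rp: "0 < real (P*h)" "real (P*h) \<le> real r" "real r \<le> real (Q*h)"
      using r PQ h by (auto simp del: of_nat_mult)
    have "ln (real (P*h)) \<le> ln (real r)" using rp by (subst ln_le_cancel_iff) linarith+
    moreover have "ln (real r) \<le> ln (real (Q*h))" using rp by (subst ln_le_cancel_iff) linarith+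
    ultimately have "0 \<le> b * (ln (real r) - ln (real (P*h)))" "b * (ln (real r) - ln (real (P*h))) \<le> b * L"
      using b lnL by (auto intro!: mult_left_mono mult_nonneg_nonneg simp del: of_nat_mult)
    thus "x2 \<le> X r" "X r \<le> x1" using X[OF r] x unfolding L_def[symmetric] by linarith+
  qed
  have reuse_wt: "C - K * (x1 + x2) + K * x2 + K * b * (ln (real r) - ln (real (P*h))) \<le> C - k / X r"
    if r: "r \<in> {P*h..<Q*h}" for r
  proof -
    have "k * (1 / X r) \<le> k * ((x1 + x2 - X r) / (x1 * x2))"
      using Xr[OF r] x k by (intro mult_left_mono inverse_secant) auto
    hence "k / X r \<le> K * (x1 + x2 - X r)" by (simp add: K_def)
    moreover have "K * (x1 + x2 - X r) \<le> K * (x1 + x2 - (x2 + b * (ln (real r) - ln (real (P*h)))))"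
      using X[OF r] x K by (intro mult_left_mono) auto
    ultimately show ?thesis by (simp add: algebra_simps)
  qed
  have "real h * (C * real (Q - P) - K * ((x1 + x2) * real (Q - P) - (x2 * real (Q - P) + b * (real Q * L - real (Q - P)))))
          - K * (b * L)
     = (C - K * (x1 + x2) + K * x2) * real (Q*h - P*h) + K * b * ((real (Q*h) - 1) * L - (real (Q*h) - real (P*h)))"
    using PQ by (simp add: of_nat_diff algebra_simps)
  also have "\<dots> \<le> (C - K * (x1 + x2) + K * x2) * real (Q*h - P*h)
      + K * b * (\<Sum>r\<in>{P*h..<Q*h}. ln (real r) - ln (real (P*h)))"
    using sum_ln_ge[of "P*h" "Q*h"] PQ h K b unfolding lnL
    by (intro add_left_mono mult_left_mono) auto
  also have "\<dots> = (\<Sum>r\<in>{P*h..<Q*h}. C - K * (x1 + x2) + K * x2 + K * b * (ln (real r) - ln (real (P*h))))"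
    by (simp only: sum.distrib sum_distrib_left[symmetric] sum_constant card_atLeastLessThan) (simp add: algebra_simps)
  also have "\<dots> \<le> (\<Sum>r\<in>{P*h..<Q*h}. C - k / X r)"
    using reuse_wt by (rule sum_mono)
  finally have main: "real h * (C * real (Q - P) - K * ((x1 + x2) * real (Q - P) - (x2 * real (Q - P) + b * (real Q * L - real (Q - P)))))
          - K * (b * L) \<le> (\<Sum>r\<in>{P*h..<Q*h}. C - k / X r)" .
  \<comment> \<open>The main term increases with the logarithm, so the rational lower bound
    \<open>l\<close> may replace it there.\<close>
  have "K * (b * (real Q * l)) \<le> K * (b * (real Q * L))"
    using l K b unfolding L_def by (intro mult_left_mono) auto
  hence "real h * (K * (b * (real Q * l))) \<le> real h * (K * (b * (real Q * L)))"
    by (rule mult_left_mono) auto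
  with main show ?thesis unfolding K_def[symmetric] L_def[symmetric] by (simp add: algebra_simps)
qed

text \<open>The factors \<open>u r - u m\<close> and \<open>q r\<close> never have opposite signs,
  so replacing \<open>u\<close> by the constant \<open>u m\<close> can only decrease the
  sum.\<close>

lemma sum_antimono_sign:
  fixes u q :: "nat \<Rightarrow> real"
  assumes "\<And>r s. r \<le> s \<Longrightarrow> s < n \<Longrightarrow> u r \<le> u s" "m < n" "0 \<le> u m"
    and "\<And>r. r < n \<Longrightarrow> m \<le> r \<Longrightarrow> 0 \<le> q r" "\<And>r. r < m \<Longrightarrow> q r \<le> 0"
    and "0 \<le> (\<Sum>r<n. q r)"
  shows "0 \<le> (\<Sum>r<n. u r * q r)"
proof -
  have "0 \<le> u m * (\<Sum>r<n. q r)" using assms by simp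
  also have "\<dots> = (\<Sum>r<n. u m * q r)" by (rule sum_distrib_left)
  also have "\<dots> \<le> (\<Sum>r<n. u r * q r)"
  proof (rule sum_mono)
    fix r assume r: "r \<in> {..<n}"
    show "u m * q r \<le> u r * q r"
    proof (cases "m \<le> r")
      case True thus ?thesis using r assms by (intro mult_right_mono) auto
    next
      case False thus ?thesis using r assms by (intro mult_right_mono_neg) auto
    qed
  qed
  finally show ?thesis .
qed

section \<open>The explicit dual solution\<close>

text \<open>A star of \<open>120 * h\<close> cities is cut into \<open>120\<close> blocks of size \<open>h\<close>. Of the unit coefficient that
  \<open>\<alpha> r\<close> needs, the fraction \<open>share (r div h)\<close> is supplied by the multiplier \<open>z r\<close> and the rest by
  \<open>\<omega> r\<close>. The steps were found numerically; they leave a surplus of about \<open>0.041 * h\<close>.\<close>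

definition share :: "nat \<Rightarrow> real" where
  "share q = (if q < 15 then 1 else if q < 25 then 0.82 else if q < 29 then 0.57
     else if q < 34 then 0.44 else if q < 38 then 0.31 else if q < 42 then 0.17
     else if q < 47 then 0.04 else 0)"

text \<open>The logarithmic difference is the exact integral of \<open>1 / y\<close> over
  \<open>[r, r + 1]\<close>, so the weights telescope where \<open>share\<close> is constant. At
  \<open>r = 0\<close>, where \<open>ln 0\<close> is a default value, the factor
  \<open>1 - share 0\<close> vanishes.\<close>

definition dual_wt :: "nat \<Rightarrow> nat \<Rightarrow> real" where
  "dual_wt h r = (1 - share (r div h)) * (ln (real (Suc r)) - ln (real r))"

definition cum_wt :: "nat \<Rightarrow> nat \<Rightarrow> real" where
  "cum_wt h r = (\<Sum>i<r. dual_wt h i)"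

text \<open>The constant is \<open>3.4035 - 1.45\<close>. The optimal \<open>\<theta>\<close> is \<open>slack / theta_den\<close>; the reconnection
  offers of the last \<open>25 * h\<close> cities are dropped, being worth less than \<open>d\<close> in the extremal instance.\<close>

definition slack :: "nat \<Rightarrow> nat \<Rightarrow> real" where
  "slack h r = 1.9535 + cum_wt h r - share (r div h)"

text \<open>The contribution of city \<open>r\<close> to the total coefficient of the \<open>u\<close>'s, see \<open>surplus_eq\<close>;
  as \<open>C - k / slack\<close> it is concave in the cumulative weight and can be bounded by secants.\<close>

definition surplus :: "nat \<Rightarrow> nat \<Rightarrow> real" where
  "surplus h r = (let a = share (r div h) in
     if r < 25 * h then - a - a\<^sup>2 / slack h r
     else 1.9535 - 4 * a - (1.9535 - 2 * a)\<^sup>2 / slack h r)"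

text \<open>The slope \<open>(\<theta> - 1) / \<theta>\<close> of \<open>reconn_ge\<close> for
  \<open>\<theta> = slack / theta_den\<close>; the cumulative weight cancels in
  \<open>slack - theta_den\<close>.\<close>

definition reuse_wt :: "nat \<Rightarrow> nat \<Rightarrow> real" where
  "reuse_wt h r = (if r < 25 * h then 0 else (1.9535 - 2 * share (r div h)) / slack h r)"

lemma share_bounds: "0 \<le> share q" "share q \<le> 1"
  by (auto simp: share_def)

lemma dual_wt_nonneg: "0 \<le> dual_wt h r"
proof (cases "r = 0")
  case True thus ?thesis by (simp add: dual_wt_def share_def)
next
  case False
  hence "ln (real r) \<le> ln (real (Suc r))" by (subst ln_le_cancel_iff) auto
  thus ?thesis using share_bounds[of "r div h"] by (auto simp: dual_wt_def)
qed

lemma cum_wt_mono: "r \<le> s \<Longrightarrow> cum_wt h r \<le> cum_wt h s"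
  unfolding cum_wt_def using dual_wt_nonneg by (intro sum_mono2) auto

lemma cum_wt_nonneg: "0 \<le> cum_wt h r"
  unfolding cum_wt_def using dual_wt_nonneg by (intro sum_nonneg) auto

lemma block_div:
  fixes P Q h r :: nat
  assumes "0 < h" "r \<in> {P*h..<Q*h}"
  shows "P \<le> r div h" "r div h < Q"
proof -
  show "P \<le> r div h" using assms less_eq_div_iff_mult_less_eq[OF assms(1)] by simp
  show "r div h < Q" using assms by (simp add: div_less_iff_less_mult)
qed

lemma cum_wt_block:
  assumes "0 < P" "0 < h" "\<And>q. P \<le> q \<Longrightarrow> q < Q \<Longrightarrow> share q = a" "P * h \<le> r" "r \<le> Q * h"
  shows "cum_wt h r = cum_wt h (P*h) + (1 - a) * (ln (real r) - ln (real (P*h)))"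
  using assms(4,5)
proof (induction r rule: dec_induct)
  case (step m)
  hence "share (m div h) = a"
    using block_div[of h m P Q] assms by auto
  moreover have "cum_wt h (Suc m) = cum_wt h m + dual_wt h m" by (simp add: cum_wt_def)
  ultimately show ?case using step by (simp add: dual_wt_def algebra_simps)
qed simp

lemma cum_wt_first: "0 < h \<Longrightarrow> r \<le> 15 * h \<Longrightarrow> cum_wt h r = 0"
  unfolding cum_wt_def
  by (intro sum.neutral ballI) (auto simp: dual_wt_def share_def div_less_iff_less_mult)

section \<open>Numerical evaluation of the total surplus\<close>

text \<open>Each block adds at most \<open>1\<close> to \<open>m\<close>, the error of replacing sums by integrals.\<close>

definition block_inv :: "nat \<Rightarrow> nat \<Rightarrow> real \<Rightarrow> real \<Rightarrow> real \<Rightarrow> real \<Rightarrow> bool" where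
  "block_inv h P lo hi J m \<longleftrightarrow> lo \<le> cum_wt h (P*h) \<and> cum_wt h (P*h) \<le> hi \<and>
     real h * J - m \<le> (\<Sum>r<P*h. surplus h r)"

lemma block_inv_15:
  assumes "0 < h"
  shows "block_inv h 15 0 0 (- 30.73152) 0"
proof -
  have "surplus h r = - 1 - 1 / (0.9535)" if "r < 15 * h" for r
  proof -
    have "r div h < 15" using that assms by (simp add: div_less_iff_less_mult)
    thus ?thesis using that cum_wt_first[OF assms, of r]
      by (auto simp: surplus_def slack_def share_def Let_def)
  qed
  hence "(\<Sum>r<15*h. surplus h r) = (\<Sum>r<15*h. - 1 - 1 / (0.9535))" by simp
  thus ?thesis using cum_wt_first[OF assms, of "15*h"] by (simp add: block_inv_def)
qed

text \<open>\<open>x2\<close> and \<open>x1\<close> enclose \<open>slack\<close> on the block, so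
  \<open>block_sum_ge\<close> applies to \<open>surplus = C - k / slack\<close>. The alternatives
  for \<open>C\<close> and \<open>k\<close> are the two branches of \<open>surplus\<close>; a block
  must not straddle \<open>25\<close>. \<open>J\<close> collects the part proportional to
  \<open>h\<close>.\<close>

lemma block_inv_step:
  fixes a C k l l' :: real
  assumes inv: "block_inv h P lo hi J m"
    and h: "0 < h" and PQ: "0 < P" "P \<le> Q"
    and a: "\<And>q. P \<le> q \<Longrightarrow> q < Q \<Longrightarrow> share q = a" "0 \<le> a" "a \<le> 1"
    and C: "25 \<le> P \<and> C = 1.9535 - 4 * a \<and> k = (1.9535 - 2 * a)\<^sup>2 \<or> Q \<le> 25 \<and> C = - a \<and> k = a\<^sup>2"
    and l: "ln (real Q / real P) \<in> {l..l'}"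
    and lo: "lo' \<le> lo + (1 - a) * l" and hi: "hi + (1 - a) * l' \<le> hi'"
    and x: "x2 = 1.9535 + lo - a" "x1 = 1.9535 + hi' - a" "0 < x2"
    and m: "k / (x1 * x2) * ((1 - a) * l') \<le> 1"
    and m': "m' = m + 1"
    and J: "J' \<le> J + (C * real (Q - P) - k / (x1 * x2) *
            ((x1 + x2) * real (Q - P) - (x2 * real (Q - P) + (1 - a) * (real Q * l - real (Q - P)))))"
  shows "block_inv h Q lo' hi' J' m'"
proof -
  have cumQ: "cum_wt h (Q*h) = cum_wt h (P*h) + (1 - a) * ln (real Q / real P)"
    using cum_wt_block[OF PQ(1) h a(1), of Q "Q*h"] PQ h by (simp add: ln_div ln_mult)
  have ll: "(1 - a) * l \<le> (1 - a) * ln (real Q / real P)" "(1 - a) * ln (real Q / real P) \<le> (1 - a) * l'"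
    using l a by (auto intro: mult_left_mono)
  have k: "0 \<le> k" using C by auto
  have X: "slack h r = (1.9535 + cum_wt h (P*h) - a) + (1 - a) * (ln (real r) - ln (real (P*h)))"
    and sp: "surplus h r = C - k / slack h r" if "r \<in> {P*h..<Q*h}" for r
  proof -
    note r' = that
    have r: "share (r div h) = a" using a(1) block_div[OF h that] by auto
    show "slack h r = (1.9535 + cum_wt h (P*h) - a) + (1 - a) * (ln (real r) - ln (real (P*h)))"
      using cum_wt_block[OF PQ(1) h a(1), of Q r] that r by (simp add: slack_def)
    have "25 * h \<le> r" if "25 \<le> P" using order.trans[OF mult_le_mono1[OF that, of h]] r' by simp
    moreover have "r < 25 * h" if "Q \<le> 25" using less_le_trans[OF _ mult_le_mono1[OF that, of h]] r' by simp
    ultimately show "surplus h r = C - k / slack h r"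
      using C r by (auto simp: surplus_def Let_def)
  qed
  have I: "lo \<le> cum_wt h (P*h)" "cum_wt h (P*h) \<le> hi" "real h * J - m \<le> (\<Sum>r<P*h. surplus h r)"
    using inv by (auto simp: block_inv_def)
  define B where "B = C * real (Q - P) - k / (x1 * x2) *
            ((x1 + x2) * real (Q - P) - (x2 * real (Q - P) + (1 - a) * (real Q * l - real (Q - P))))"
  have lohi: "0 \<le> (1 - a) * l'" using ll(2) PQ a
    by (intro order.trans[OF _ ll(2)] mult_nonneg_nonneg) auto
  have x1: "0 < x1" using x lohi hi I by linarith
  have "real h * B - k / (x1 * x2) * ((1 - a) * ln (real Q / real P)) \<le> (\<Sum>r\<in>{P*h..<Q*h}. C - k / slack h r)"
    unfolding B_def using PQ h k a X x I hi ll l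
    by (intro block_sum_ge[where ?x0.0 = "1.9535 + cum_wt h (P*h) - a"]) auto
  moreover have "k / (x1 * x2) * ((1 - a) * ln (real Q / real P)) \<le> k / (x1 * x2) * ((1 - a) * l')"
    using ll(2) k x x1 by (intro mult_left_mono[OF ll(2)]) auto
  ultimately have blk: "real h * B - 1 \<le> (\<Sum>r\<in>{P*h..<Q*h}. surplus h r)"
    using m sp by simp
  have "(\<Sum>r<Q*h. surplus h r) = (\<Sum>r<P*h. surplus h r) + (\<Sum>r\<in>{P*h..<Q*h}. surplus h r)"
    using PQ sum.atLeastLessThan_concat[of 0 "P*h" "Q*h" "surplus h"] by (simp add: atLeast0LessThan)
  moreover have "real h * J' \<le> real h * (J + B)"
    using J h unfolding B_def by (intro mult_left_mono) auto
  ultimately have "real h * J' - (m + 1) \<le> (\<Sum>r<Q*h. surplus h r)"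
    using blk I by (simp add: algebra_simps)
  thus ?thesis using cumQ ll lo hi I m' by (auto simp: block_inv_def)
qed

lemma block_inv_25:
  assumes "0 < h"
  shows "block_inv h 25 0.091948 0.091949 (- 44.62218) 1"
proof (rule block_inv_step[OF block_inv_15[OF assms] assms, where a = "0.82" and C = "- 0.82"
    and k = "0.82\<^sup>2" and ?x1.0 = "1.225449" and ?x2.0 = "1.1335"])
  show "ln (real 25 / real 15) \<in> {0.510825..0.510826}"
    using ln_approx_bounds[of "5 / 3" 6] by (simp add: eval_nat_numeral)
qed (simp_all add: share_def power2_eq_square)

lemma block_inv_29:
  assumes "0 < h"
  shows "block_inv h 29 0.155768 0.155771 (- 47.68419) 2"
proof (rule block_inv_step[OF block_inv_25[OF assms] assms, where a = "0.57" and C = "- 0.3265"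
    and k = "0.8135\<^sup>2" and ?x1.0 = "1.539271" and ?x2.0 = "1.475448"])
  show "ln (real 29 / real 25) \<in> {0.148419..0.148421}"
    using ln_approx_bounds[of "29 / 25" 3] by (simp add: eval_nat_numeral)
qed (simp_all add: share_def power2_eq_square)

lemma block_inv_34:
  assumes "0 < h"
  shows "block_inv h 34 0.244843 0.244848 (- 50.07877) 3"
proof (rule block_inv_step[OF block_inv_29[OF assms] assms, where a = "0.44" and C = "0.1935"
    and k = "1.0735\<^sup>2" and ?x1.0 = "1.758348" and ?x2.0 = "1.669268"])
  show "ln (real 34 / real 29) \<in> {0.159064..0.159065}"
    using ln_approx_bounds[of "34 / 29" 3] by (simp add: eval_nat_numeral)
qed (simp_all add: share_def power2_eq_square)

lemma block_inv_38:
  assumes "0 < h"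
  shows "block_inv h 38 0.321588 0.321594 (- 50.9166) 4"
proof (rule block_inv_step[OF block_inv_34[OF assms] assms, where a = "0.31" and C = "0.7135"
    and k = "1.3335\<^sup>2" and ?x1.0 = "1.965094" and ?x2.0 = "1.888343"])
  show "ln (real 38 / real 34) \<in> {0.111225..0.111226}"
    using ln_approx_bounds[of "19 / 17" 3] by (simp add: eval_nat_numeral)
qed (simp_all add: share_def power2_eq_square)

lemma block_inv_42:
  assumes "0 < h"
  shows "block_inv h 42 0.404656 0.404664 (- 50.67399) 5"
proof (rule block_inv_step[OF block_inv_38[OF assms] assms, where a = "0.17" and C = "1.2735"
    and k = "1.6135\<^sup>2" and ?x1.0 = "2.188164" and ?x2.0 = "2.105088"])
  show "ln (real 42 / real 38) \<in> {0.100083..0.100084}"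
    using ln_approx_bounds[of "21 / 19" 3] by (simp add: eval_nat_numeral)
qed (simp_all add: share_def power2_eq_square)

lemma block_inv_47:
  assumes "0 < h"
  shows "block_inv h 47 0.512633 0.512644 (- 49.10557) 6"
proof (rule block_inv_step[OF block_inv_42[OF assms] assms, where a = "0.04" and C = "1.7935"
    and k = "1.8735\<^sup>2" and ?x1.0 = "2.426144" and ?x2.0 = "2.318156"])
  show "ln (real 47 / real 42) \<in> {0.112477..0.112479}"
    using ln_approx_bounds[of "47 / 42" 3] by (simp add: eval_nat_numeral)
qed (simp_all add: share_def power2_eq_square)

text \<open>From \<open>47\<close> on \<open>share\<close> is \<open>0\<close>, and the remaining
  cuts only shorten the chords: a single chord up to \<open>120\<close> would lose more than the
  final surplus.\<close>

lemma block_inv_56: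
  assumes "0 < h"
  shows "block_inv h 56 0.687836 0.687849 (- 44.97559) 7"
proof (rule block_inv_step[OF block_inv_47[OF assms] assms, where a = "0" and C = "1.9535"
    and k = "1.9535\<^sup>2" and ?x1.0 = "2.641349" and ?x2.0 = "2.466133"])
  show "ln (real 56 / real 47) \<in> {0.175203..0.175205}"
    using ln_approx_bounds[of "56 / 47" 3] by (simp add: eval_nat_numeral)
qed (simp_all add: share_def power2_eq_square)

lemma block_inv_68:
  assumes "0 < h"
  shows "block_inv h 68 0.881991 0.882006 (- 38.25828) 8"
proof (rule block_inv_step[OF block_inv_56[OF assms] assms, where a = "0" and C = "1.9535"
    and k = "1.9535\<^sup>2" and ?x1.0 = "2.835506" and ?x2.0 = "2.641336"])
  show "ln (real 68 / real 56) \<in> {0.194155..0.194157}"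
    using ln_approx_bounds[of "17 / 14" 3] by (simp add: eval_nat_numeral)
qed (simp_all add: share_def power2_eq_square)

lemma block_inv_82:
  assumes "0 < h"
  shows "block_inv h 82 1.069202 1.069218 (- 29.1496) 9"
proof (rule block_inv_step[OF block_inv_68[OF assms] assms, where a = "0" and C = "1.9535"
    and k = "1.9535\<^sup>2" and ?x1.0 = "3.022718" and ?x2.0 = "2.835491"])
  show "ln (real 82 / real 68) \<in> {0.187211..0.187212}"
    using ln_approx_bounds[of "41 / 34" 3] by (simp add: eval_nat_numeral)
qed (simp_all add: share_def power2_eq_square)

lemma block_inv_99:
  assumes "0 < h"
  shows "block_inv h 99 1.257602 1.257619 (- 16.75326) 10"
proof (rule block_inv_step[OF block_inv_82[OF assms] assms, where a = "0" and C = "1.9535"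
    and k = "1.9535\<^sup>2" and ?x1.0 = "3.211119" and ?x2.0 = "3.022702"])
  show "ln (real 99 / real 82) \<in> {0.1884..0.188401}"
    using ln_approx_bounds[of "99 / 82" 3] by (simp add: eval_nat_numeral)
qed (simp_all add: share_def power2_eq_square)

lemma block_inv_120:
  assumes "0 < h"
  shows "block_inv h 120 1.449973 1.449992 0.04113 11"
proof (rule block_inv_step[OF block_inv_99[OF assms] assms, where a = "0" and C = "1.9535"
    and k = "1.9535\<^sup>2" and ?x1.0 = "3.403492" and ?x2.0 = "3.211102"])
  show "ln (real 120 / real 99) \<in> {0.192371..0.192373}"
    using ln_approx_bounds[of "40 / 33" 3] by (simp add: eval_nat_numeral)
qed (simp_all add: share_def power2_eq_square)

section \<open>Signs of the coefficients of the \<open>u\<close> variables\<close>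

lemma cum_wt_bounds:
  assumes h: "0 < h"
  shows "r \<le> 120*h \<Longrightarrow> cum_wt h r \<le> 1.45" "25*h \<le> r \<Longrightarrow> 0.091948 \<le> cum_wt h r"
    "r \<le> 25*h \<Longrightarrow> cum_wt h r \<le> 0.091949"
  using block_inv_25[OF h] block_inv_120[OF h] cum_wt_mono[of r "120*h" h] cum_wt_mono[of "25*h" r h] cum_wt_mono[of r "25*h" h]
  by (auto simp: block_inv_def)

lemma share_late: "25 \<le> q \<Longrightarrow> share q \<le> 0.57" and share_early: "q < 25 \<Longrightarrow> 0.82 \<le> share q"
  by (auto simp: share_def)

lemma slack_pos: "0 < slack h r"
  using cum_wt_nonneg[of h r] share_bounds[of "r div h"] by (simp add: slack_def)

lemma reuse_wt_nonneg:
  assumes "0 < h"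
  shows "0 \<le> reuse_wt h r"
proof (cases "r < 25*h")
  case False
  hence "25 \<le> r div h" using assms by (simp add: less_eq_div_iff_mult_less_eq)
  thus ?thesis using share_late slack_pos[of h r] by (force simp: reuse_wt_def)
qed (simp add: reuse_wt_def)

lemma reuse_wt_le_one: "reuse_wt h r \<le> 1"
  using slack_pos[of h r] cum_wt_nonneg[of h r] share_bounds[of "r div h"]
  by (auto simp: reuse_wt_def slack_def)

text \<open>Tail sums are built backwards from \<open>120\<close>. For constant \<open>share\<close>
  the weight decreases in \<open>slack\<close>, so the bound on \<open>cum_wt\<close> at the right
  end serves the whole block.\<close>

lemma reuse_wt_sum_step:
  fixes a g :: real
  assumes h: "0 < h" and PQ: "25 \<le> P" "P \<le> Q" "Q \<le> 120"
    and g: "real h * g \<le> (\<Sum>j\<in>{Q*h..<120*h}. reuse_wt h j)"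
    and a: "\<And>q. P \<le> q \<Longrightarrow> q < Q \<Longrightarrow> share q = a" "a \<le> 0.57"
    and hi: "block_inv h Q lo hi J m"
    and x: "x = 1.9535 + hi - a"
    and g': "g' \<le> g + real (Q - P) * ((1.9535 - 2 * a) / x)"
  shows "real h * g' \<le> (\<Sum>j\<in>{P*h..<120*h}. reuse_wt h j)"
proof -
  have p: "(1.9535 - 2 * a) / x \<le> reuse_wt h j" if j: "j \<in> {P*h..<Q*h}" for j
  proof -
    have r: "share (j div h) = a" using a(1) block_div[OF h j] by auto
    have "cum_wt h j \<le> hi" using cum_wt_mono[of j "Q*h" h] j hi by (auto simp: block_inv_def)
    hence "slack h j \<le> x" using r x by (simp add: slack_def)
    moreover have "25 * h \<le> j" using order.trans[OF mult_le_mono1[OF PQ(1), of h]] j by simp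
    ultimately show ?thesis using r a(2) slack_pos[of h j]
      by (auto simp: reuse_wt_def intro!: divide_left_mono mult_pos_pos)
  qed
  have "real h * g' \<le> real h * g + real h * (real (Q - P) * ((1.9535 - 2 * a) / x))"
    using mult_left_mono[OF g', of "real h"] by (simp add: algebra_simps)
  also have "real h * (real (Q - P) * ((1.9535 - 2 * a) / x)) = (\<Sum>j\<in>{P*h..<Q*h}. (1.9535 - 2 * a) / x)"
    using PQ by (simp add: of_nat_diff algebra_simps)
  also have "\<dots> \<le> (\<Sum>j\<in>{P*h..<Q*h}. reuse_wt h j)"
    using p by (rule sum_mono)
  finally have "real h * g' \<le> (\<Sum>j\<in>{P*h..<Q*h}. reuse_wt h j) + (\<Sum>j\<in>{Q*h..<120*h}. reuse_wt h j)"
    using g by simp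
  thus ?thesis using sum.atLeastLessThan_concat[of "P*h" "Q*h" "120*h" "reuse_wt h"] PQ by simp
qed

text \<open>\<open>\<theta> = slack / theta_den\<close> solves
  \<open>s j * cum_wt + tri_wt * \<theta> = 1.9535 + cum_wt\<close>, which makes the constraint
  \<open>dc\<close> of \<open>weighted_star\<close> as tight as possible. For early cities
  \<open>s j = 0\<close>, whence the two cases.\<close>

definition theta_den :: "nat \<Rightarrow> nat \<Rightarrow> real" where
  "theta_den h r = (if r < 25*h then share (r div h) else cum_wt h r + share (r div h))"

lemma theta_den_pos: "0 < h \<Longrightarrow> 0 < theta_den h r"
  using cum_wt_bounds(2)[of h r] share_early[of "r div h"] share_bounds[of "r div h"]
  by (auto simp: theta_den_def div_less_iff_less_mult not_less)

text \<open>Chosen so that \<open>tri_wt * \<theta> / (1 + \<theta>) = share\<close>, the fraction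
  of the coefficient of \<open>\<alpha> r\<close> that this multiplier has to supply.\<close>

definition tri_wt :: "nat \<Rightarrow> nat \<Rightarrow> real" where
  "tri_wt h r = share (r div h) * (1 + theta_den h r / slack h r)"

text \<open>\<open>dual_wt\<close> is at least \<open>(1 - a) / (Q * h)\<close> and the tail at
  least \<open>h * g\<close>, so the block size cancels. As \<open>tri_wt\<close> increases with the
  cumulative weight, the single numerical inequality \<open>num\<close> covers the block.\<close>

lemma weight_sign_block:
  fixes a g :: real
  assumes h: "0 < h" and PQ: "25 \<le> P" "P \<le> Q" "Q \<le> 120"
    and g: "real h * g \<le> (\<Sum>j\<in>{Q*h..<120*h}. reuse_wt h j)" "0 \<le> g"
    and a: "\<And>q. P \<le> q \<Longrightarrow> q < Q \<Longrightarrow> share q = a" "0 \<le> a" "a \<le> 0.57"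
    and hi: "block_inv h Q lo hi J m"
    and num: "a * (1 + (hi + a) / (1.9535 + hi - a)) \<le> (1 - a) / real Q * g"
    and r: "r \<in> {P*h..<Q*h}"
  shows "0 \<le> dual_wt h r * (\<Sum>j\<in>{r<..<120*h}. reuse_wt h j) - tri_wt h r"
proof -
  have rr: "share (r div h) = a" using a(1) block_div[OF h r] by auto
  have r25: "25 * h \<le> r" using order.trans[OF mult_le_mono1[OF PQ(1), of h]] r by simp
  hence r0: "0 < r" using h by simp
  have Q120: "Q * h \<le> 120 * h" using PQ by simp
  have cum_wt: "cum_wt h r \<le> hi" using cum_wt_mono[of r "Q*h" h] r hi by (auto simp: block_inv_def)
  have G: "real h * g \<le> (\<Sum>j\<in>{r<..<120*h}. reuse_wt h j)"
    by (rule order.trans[OF g(1)], rule sum_mono2) (use reuse_wt_nonneg[OF h] r in auto)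
  have "1 / (real r + 1) \<le> ln (real (Suc r)) - ln (real r)"
  proof -
    have "ln (real r / real (Suc r)) \<le> real r / real (Suc r) - 1"
      using r0 by (intro ln_le_minus_one) auto
    thus ?thesis using r0 by (simp add: ln_div field_simps)
  qed
  moreover have "1 / (real Q * real h) \<le> 1 / (real r + 1)"
  proof -
    have "real (r + 1) \<le> real (Q * h)" using r by (intro of_nat_mono) auto
    thus ?thesis using r0 by (intro divide_left_mono) (auto intro!: mult_pos_pos)
  qed
  ultimately have w: "(1 - a) * (1 / (real Q * real h)) \<le> dual_wt h r"
    using a rr unfolding dual_wt_def by (intro mult_mono) auto
  have "(1 - a) / real Q * g = (1 - a) * (1 / (real Q * real h)) * (real h * g)"
    using h by simp
  also have "\<dots> \<le> dual_wt h r * (\<Sum>j\<in>{r<..<120*h}. reuse_wt h j)"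
    using w G g dual_wt_nonneg by (intro mult_mono) auto
  finally have "a * (1 + (hi + a) / (1.9535 + hi - a)) \<le> dual_wt h r * (\<Sum>j\<in>{r<..<120*h}. reuse_wt h j)"
    using num by linarith
  moreover have "tri_wt h r \<le> a * (1 + (hi + a) / (1.9535 + hi - a))"
  proof -
    have s: "slack h r = 1.9535 + cum_wt h r - a" "theta_den h r = cum_wt h r + a"
      using rr r25 by (auto simp: slack_def theta_den_def)
    have "(cum_wt h r + a) / (1.9535 + cum_wt h r - a) \<le> (hi + a) / (1.9535 + hi - a)"
    proof -
      have "0 \<le> (hi - cum_wt h r) * (1.9535 - 2 * a)" using cum_wt a by simp
      moreover have "0 < 1.9535 + cum_wt h r - a" using slack_pos[of h r] s by simp
      ultimately show ?thesis using cum_wt by (simp add: divide_simps) (simp add: algebra_simps)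
    qed
    thus ?thesis using a unfolding tri_wt_def s rr by (intro mult_left_mono) auto
  qed
  ultimately show ?thesis by linarith
qed

lemma weight_sign_late:
  assumes h: "0 < h" and r: "25 * h \<le> r" "r < 120 * h"
  shows "0 \<le> dual_wt h r * (\<Sum>j\<in>{r<..<120*h}. reuse_wt h j) - tri_wt h r"
proof -
  have g120: "real h * 0 \<le> (\<Sum>j\<in>{120*h..<120*h}. reuse_wt h j)" by simp
  have g99: "real h * 12.053 \<le> (\<Sum>j\<in>{99*h..<120*h}. reuse_wt h j)"
    by (rule reuse_wt_sum_step[OF h _ _ _ g120 _ _ block_inv_120[OF h] refl, where a = "0"]) (simp_all add: share_def)
  have g82: "real h * 22.395 \<le> (\<Sum>j\<in>{82*h..<120*h}. reuse_wt h j)"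
    by (rule reuse_wt_sum_step[OF h _ _ _ g99 _ _ block_inv_99[OF h] refl, where a = "0"]) (simp_all add: share_def)
  have g68: "real h * 31.442 \<le> (\<Sum>j\<in>{68*h..<120*h}. reuse_wt h j)"
    by (rule reuse_wt_sum_step[OF h _ _ _ g82 _ _ block_inv_82[OF h] refl, where a = "0"]) (simp_all add: share_def)
  have g56: "real h * 39.709 \<le> (\<Sum>j\<in>{56*h..<120*h}. reuse_wt h j)"
    by (rule reuse_wt_sum_step[OF h _ _ _ g68 _ _ block_inv_68[OF h] refl, where a = "0"]) (simp_all add: share_def)
  have g47: "real h * 46.365 \<le> (\<Sum>j\<in>{47*h..<120*h}. reuse_wt h j)"
    by (rule reuse_wt_sum_step[OF h _ _ _ g56 _ _ block_inv_56[OF h] refl, where a = "0"]) (simp_all add: share_def)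
  have g42: "real h * 50.226 \<le> (\<Sum>j\<in>{42*h..<120*h}. reuse_wt h j)"
    by (rule reuse_wt_sum_step[OF h _ _ _ g47 _ _ block_inv_47[OF h] refl, where a = "0.04"]) (simp_all add: share_def)
  have g38: "real h * 53.175 \<le> (\<Sum>j\<in>{38*h..<120*h}. reuse_wt h j)"
    by (rule reuse_wt_sum_step[OF h _ _ _ g42 _ _ block_inv_42[OF h] refl, where a = "0.17"]) (simp_all add: share_def)
  have g34: "real h * 55.889 \<le> (\<Sum>j\<in>{34*h..<120*h}. reuse_wt h j)"
    by (rule reuse_wt_sum_step[OF h _ _ _ g38 _ _ block_inv_38[OF h] refl, where a = "0.31"]) (simp_all add: share_def)
  have g29: "real h * 58.941 \<le> (\<Sum>j\<in>{29*h..<120*h}. reuse_wt h j)"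
    by (rule reuse_wt_sum_step[OF h _ _ _ g34 _ _ block_inv_34[OF h] refl, where a = "0.44"]) (simp_all add: share_def)
  have s47: ?thesis if "r \<in> {42*h..<47*h}"
    by (rule weight_sign_block[OF h _ _ _ g47 _ _ _ _ block_inv_47[OF h] _ that, where a = "0.04"]) (simp_all add: share_def)
  have s42: ?thesis if "r \<in> {38*h..<42*h}"
    by (rule weight_sign_block[OF h _ _ _ g42 _ _ _ _ block_inv_42[OF h] _ that, where a = "0.17"]) (simp_all add: share_def)
  have s38: ?thesis if "r \<in> {34*h..<38*h}"
    by (rule weight_sign_block[OF h _ _ _ g38 _ _ _ _ block_inv_38[OF h] _ that, where a = "0.31"]) (simp_all add: share_def)
  have s34: ?thesis if "r \<in> {29*h..<34*h}"
    by (rule weight_sign_block[OF h _ _ _ g34 _ _ _ _ block_inv_34[OF h] _ that, where a = "0.44"]) (simp_all add: share_def)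
  have s29: ?thesis if "r \<in> {25*h..<29*h}"
    by (rule weight_sign_block[OF h _ _ _ g29 _ _ _ _ block_inv_29[OF h] _ that, where a = "0.57"]) (simp_all add: share_def)
  have z: ?thesis if "47*h \<le> r"
  proof -
    have "share (r div h) = 0" using less_eq_div_iff_mult_less_eq[OF h, of 47 r] that by (simp add: share_def)
    hence "tri_wt h r = 0" by (simp add: tri_wt_def)
    thus ?thesis using dual_wt_nonneg reuse_wt_nonneg[OF h] by (auto intro!: mult_nonneg_nonneg sum_nonneg)
  qed
  show ?thesis
    using r s29 s34 s38 s42 s47 z
    by (cases "r < 29*h"; cases "r < 34*h"; cases "r < 38*h"; cases "r < 42*h"; cases "r < 47*h") auto
qed

text \<open>Crude bounds suffice. Below \<open>15 * h\<close> there is no positive term; above, at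
  most \<open>95 * h\<close> cities contribute at most \<open>1\<close> each, which gives
  \<open>0.18 * 95 / 15 = 1.14\<close>.\<close>

lemma weight_sign_early:
  assumes h: "0 < h" and r: "r < 25 * h"
  shows "dual_wt h r * (\<Sum>j\<in>{r<..<120*h}. reuse_wt h j) - tri_wt h r \<le> 0"
proof (cases "r < 15 * h")
  case True
  hence "share (r div h) = 1" using h by (simp add: share_def div_less_iff_less_mult)
  thus ?thesis using slack_pos[of h r] r by (simp add: dual_wt_def tri_wt_def theta_den_def field_simps)
next
  case False
  hence rr: "share (r div h) = 0.82" using h r less_eq_div_iff_mult_less_eq[OF h, of 15 r]
    by (simp add: share_def div_less_iff_less_mult not_less)
  have r0: "0 < r" using False h by simp
  have "(\<Sum>j\<in>{r<..<120*h}. reuse_wt h j) = (\<Sum>j\<in>{25*h..<120*h}. reuse_wt h j)"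
    using r by (intro sum.mono_neutral_right) (auto simp: reuse_wt_def)
  also have "\<dots> \<le> (\<Sum>j\<in>{25*h..<120*h}. 1)" using reuse_wt_le_one by (intro sum_mono)
  finally have G: "(\<Sum>j\<in>{r<..<120*h}. reuse_wt h j) \<le> 95 * real h" by (simp add: of_nat_diff)
  have "ln (real (Suc r) / real r) \<le> real (Suc r) / real r - 1"
    using r0 by (intro ln_le_minus_one) auto
  hence "ln (real (Suc r)) - ln (real r) \<le> 1 / real r" using r0 by (simp add: ln_div field_simps)
  also have "\<dots> \<le> 1 / (15 * real h)"
    using False r0 h by (intro divide_left_mono) (auto intro!: mult_pos_pos simp: not_less)
  finally have w: "dual_wt h r \<le> 0.18 * (1 / (15 * real h))" unfolding dual_wt_def rr by simp
  have "dual_wt h r * (\<Sum>j\<in>{r<..<120*h}. reuse_wt h j) \<le> 0.18 * (1 / (15 * real h)) * (95 * real h)"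
    using G w dual_wt_nonneg reuse_wt_nonneg[OF h] by (intro mult_mono) (auto intro!: sum_nonneg)
  also have "\<dots> = 1.14" using h by simp
  also have "\<dots> \<le> tri_wt h r"
  proof -
    have "slack h r \<le> 1.3" using cum_wt_bounds(3)[OF h, of r] r by (simp add: slack_def rr)
    hence "0.82 / (1.3) \<le> theta_den h r / slack h r"
      using slack_pos[of h r] r unfolding theta_den_def rr by (simp only: if_True) (rule divide_left_mono, auto)
    thus ?thesis by (simp add: tri_wt_def rr)
  qed
  finally show ?thesis by simp
qed

lemma surplus_eq: "reuse_wt h r * cum_wt h r - tri_wt h r = surplus h r"
  using slack_pos[of h r]
  by (simp add: reuse_wt_def tri_wt_def theta_den_def surplus_def slack_def Let_def divide_simps power2_eq_square)
     (simp add: algebra_simps)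

lemma surplus_sum_nonneg:
  assumes h: "300 \<le> h"
  shows "0 \<le> (\<Sum>r<120*h. surplus h r)"
proof -
  \<comment> \<open>Since \<open>300 * 0.04113 > 11\<close>, the main term outweighs the errors of
    the eleven blocks.\<close>
  have "real h * 0.04113 - 11 \<le> (\<Sum>r<120*h. surplus h r)"
    using block_inv_120[of h] h by (simp add: block_inv_def)
  thus ?thesis using h by simp
qed

section \<open>The star inequality from the dual solution\<close>

lemma star_scaled:
  assumes h: "300 \<le> h" and feas: "star_feasible (120*h) \<alpha> d u f" and f: "0 \<le> f"
  shows "(\<Sum>r<120*h. \<alpha> r) \<le> 1.45 * f + 3.4035 * (\<Sum>r<120*h. d r)"
proof -
  let ?n = "120*h"
  have h0: "0 < h" using h by simp
  define \<theta> where "\<theta> r = slack h r / theta_den h r" for r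
  define s where "s r = (if r < 25*h then 0 else \<theta> r)" for r
  have tp: "0 < \<theta> r" for r using slack_pos theta_den_pos[OF h0] by (simp add: \<theta>_def)
  have za: "tri_wt h r * (\<theta> r / (1 + \<theta> r)) = share (r div h)"
           "tri_wt h r * \<theta> r = share (r div h) * (1 + \<theta> r)" for r
  proof -
    have "slack h r + theta_den h r \<noteq> 0" using slack_pos[of h r] theta_den_pos[OF h0, of r] by linarith
    thus "tri_wt h r * (\<theta> r / (1 + \<theta> r)) = share (r div h)" "tri_wt h r * \<theta> r = share (r div h) * (1 + \<theta> r)"
      using slack_pos[of h r] theta_den_pos[OF h0, of r] by (simp_all add: tri_wt_def \<theta>_def divide_simps)
  qed
  have late: "25 \<le> r div h" if "\<not> r < 25*h" for r
    using that less_eq_div_iff_mult_less_eq[OF h0, of 25 r] by simp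
  have feasD: "0 \<le> \<alpha> r" "0 \<le> d r" "0 \<le> u r" "sqrt (\<alpha> r) \<le> sqrt (u r) + sqrt (d r)" if "r < ?n" for r
    using feas that by (auto simp: star_feasible_def)
  have "(\<Sum>r<?n. \<alpha> r) \<le> (\<Sum>r<?n. dual_wt h r) * f + 3.4035 * (\<Sum>r<?n. d r)"
  proof (rule weighted_star[OF feas, where z = "tri_wt h" and \<tau> = "\<lambda>r. \<theta> r / (1 + \<theta> r)" and \<theta> = \<theta> and p = "reuse_wt h" and s = s])
    fix r assume r: "r < ?n"
    show "0 \<le> dual_wt h r" by (rule dual_wt_nonneg)
    show "0 \<le> tri_wt h r" using share_bounds slack_pos[of h r] theta_den_pos[OF h0, of r] by (simp add: tri_wt_def)
    \<comment> \<open>The offers have to supply the remaining \<open>1 - share\<close>, by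
      \<open>(r + 1) * ln ((r + 1) / r) \<ge> 1\<close>. The index \<open>0\<close> does not occur
      here because its share is \<open>1\<close>.\<close>
    have "(1 - share (r div h)) * 1 \<le> (1 - share (r div h)) * ((ln (real (Suc r)) - ln (real r)) * (real r + 1))"
      if "share (r div h) < 1"
    proof (rule mult_left_mono)
      have r0: "0 < r" using that by (cases r) (auto simp: share_def)
      hence "ln (real r / real (Suc r)) \<le> real r / real (Suc r) - 1"
        by (intro ln_le_minus_one) auto
      thus "1 \<le> (ln (real (Suc r)) - ln (real r)) * (real r + 1)" using r0 by (simp add: ln_div field_simps)
    qed (use that in simp)
    hence "1 - share (r div h) \<le> dual_wt h r * (real r + 1)"
      using share_bounds(2)[of "r div h"] dual_wt_nonneg[of h r] by (cases "share (r div h) < 1") (auto simp: dual_wt_def mult.assoc)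
    thus "1 \<le> dual_wt h r * (real r + 1) + tri_wt h r * (\<theta> r / (1 + \<theta> r))" unfolding za by linarith
    show "\<theta> r / (1 + \<theta> r) * \<alpha> r - \<theta> r * d r \<le> u r"
      using feasD[OF r] by (intro budget_le tp) auto
  next
    fix r j assume r: "r < ?n" and j: "j < ?n"
    show "reuse_wt h j * u r - s j * d j \<le> reconn (u r) (d j)"
    proof (cases "j < 25*h")
      case True thus ?thesis by (simp add: reuse_wt_def s_def reconn_nonneg)
    next
      case False
      have "1 \<le> \<theta> j"
        using share_late[OF late[OF False]] theta_den_pos[OF h0, of j] False by (simp add: \<theta>_def slack_def theta_den_def)
      moreover have "reuse_wt h j = (\<theta> j - 1) / \<theta> j"
        using False slack_pos[of h j] theta_den_pos[OF h0, of j]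
        by (simp add: reuse_wt_def \<theta>_def field_simps) (simp add: slack_def theta_den_def algebra_simps)
      ultimately show ?thesis using feasD[OF r] feasD[OF j] False reconn_ge[of "\<theta> j" "u r" "d j"] by (simp add: s_def)
    qed
  next
    fix j assume j: "j < ?n"
    have "(\<Sum>i<?n. dual_wt h i) = (\<Sum>i<j. dual_wt h i) + (\<Sum>i\<in>{j..<?n}. dual_wt h i)"
      using j sum.atLeastLessThan_concat[of 0 j ?n "dual_wt h"] by (simp add: atLeast0LessThan)
    hence "(\<Sum>i\<in>{j..<?n}. dual_wt h i) + cum_wt h j \<le> 1.45"
      using cum_wt_bounds(1)[OF h0, of ?n] by (simp add: cum_wt_def)
    moreover have "s j * cum_wt h j + tri_wt h j * \<theta> j = 1.9535 + cum_wt h j"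
    proof -
      have "\<theta> j * theta_den h j = slack h j" using theta_den_pos[OF h0, of j] by (simp add: \<theta>_def)
      thus ?thesis unfolding za by (auto simp: s_def theta_den_def slack_def algebra_simps split: if_splits)
    qed
    ultimately show "(\<Sum>i\<in>{j..<?n}. dual_wt h i) + s j * (\<Sum>i<j. dual_wt h i) + tri_wt h j * \<theta> j \<le> 3.4035"
      unfolding cum_wt_def[symmetric] by simp
  next
    let ?q = "\<lambda>r. dual_wt h r * (\<Sum>j\<in>{r<..<?n}. reuse_wt h j) - tri_wt h r"
    \<comment> \<open>Exchanging the sums credits each pair to its larger index, so that the total
      becomes a sum of \<open>surplus\<close>.\<close>
    have "(\<Sum>r<?n. dual_wt h r * (\<Sum>j\<in>{r<..<?n}. reuse_wt h j)) = (\<Sum>r<?n. \<Sum>j<?n. if r < j then dual_wt h r * reuse_wt h j else 0)"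
      by (intro sum.cong) (auto simp: sum_distrib_left sum.If_cases intro!: sum.cong)
    also have "\<dots> = (\<Sum>j<?n. \<Sum>r<?n. if r < j then dual_wt h r * reuse_wt h j else 0)"
      by (rule sum.swap)
    also have "\<dots> = (\<Sum>j<?n. reuse_wt h j * cum_wt h j)"
    proof (intro sum.cong refl)
      fix j assume "j \<in> {..<?n}"
      hence "(\<Sum>r<?n. if r < j then dual_wt h r * reuse_wt h j else 0) = (\<Sum>r<j. dual_wt h r * reuse_wt h j)"
        by (intro sum.mono_neutral_cong_right) auto
      thus "(\<Sum>r<?n. if r < j then dual_wt h r * reuse_wt h j else 0) = reuse_wt h j * cum_wt h j"
        by (simp add: cum_wt_def sum_distrib_left mult.commute)
    qed
    finally have "(\<Sum>r<?n. ?q r) = (\<Sum>r<?n. surplus h r)"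
      by (simp add: sum_subtractf surplus_eq[symmetric])
    hence "0 \<le> (\<Sum>r<?n. ?q r)" using surplus_sum_nonneg[OF h] by simp
    thus "0 \<le> (\<Sum>r<?n. u r * ?q r)"
      using h0 feas weight_sign_late[OF h0] weight_sign_early[OF h0] feasD(3)[of "25*h"]
      by (intro sum_antimono_sign[where m = "25*h"]) (auto simp: star_feasible_def)
  qed
  moreover have "(\<Sum>r<?n. dual_wt h r) * f \<le> 1.45 * f"
    using cum_wt_bounds(1)[OF h0, of ?n] f by (intro mult_right_mono) (simp_all add: cum_wt_def)
  ultimately show ?thesis by linarith
qed

lemma sum_div_lessThan:
  fixes g :: "nat \<Rightarrow> real"
  assumes N: "0 < N"
  shows "(\<Sum>r<n*N. g (r div N)) = real N * (\<Sum>i<n. g i)"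
proof -
  have "(\<Sum>r<n*N. g (r div N)) = (\<Sum>i<n. \<Sum>r\<in>{i*N..<i*N+N}. g (r div N))"
    by (rule sum.nat_group[symmetric])
  also have "\<dots> = (\<Sum>i<n. \<Sum>r\<in>{i*N..<i*N+N}. g i)"
  proof (intro sum.cong refl)
    fix i r assume "r \<in> {i*N..<i*N+N}"
    hence "r div N = i" by (intro div_nat_eqI) (auto simp: algebra_simps)
    thus "g (r div N) = g i" by simp
  qed
  finally show ?thesis by (simp add: sum_distrib_left)
qed

text \<open>Copying each city \<open>N\<close> times makes the error terms of \<open>block_inv\<close> negligible.\<close>

lemma star_feasible_duplicate:
  assumes feas: "star_feasible n \<alpha> d u f" and N: "0 < N"
  shows "star_feasible (n*N) (\<lambda>r. \<alpha> (r div N)) (\<lambda>r. d (r div N)) (\<lambda>r. u (r div N)) (real N * f)"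
proof -
  have dn: "r div N < n" if "r < n*N" for r using that N by (simp add: div_less_iff_less_mult)
  have "(\<Sum>j<n*N. if j \<le> r then max 0 (\<alpha> (r div N) - d (j div N)) else reconn (u (r div N)) (d (j div N))) \<le> real N * f"
    if r: "r < n*N" for r
  proof -
    let ?g = "\<lambda>j. if j \<le> r div N then max 0 (\<alpha> (r div N) - d j) else reconn (u (r div N)) (d j)"
    have "(\<Sum>j<n*N. if j \<le> r then max 0 (\<alpha> (r div N) - d (j div N)) else reconn (u (r div N)) (d (j div N)))
        \<le> (\<Sum>j<n*N. ?g (j div N))"
    proof (rule sum_mono)
      fix j
      have "j \<le> r \<Longrightarrow> j div N \<le> r div N" "\<not> j \<le> r \<Longrightarrow> r div N \<le> j div N" by (auto intro: div_le_mono)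
      \<comment> \<open>Copies of one city can lie on both sides of \<open>r\<close>, and those
        beyond \<open>r\<close> offer only by \<open>reconn\<close>. Here the diagonal condition of
        \<open>star_feasible\<close> enters.\<close>
      moreover have "reconn (u (r div N)) (d (r div N)) \<le> max 0 (\<alpha> (r div N) - d (r div N))"
        using feas dn[OF r] by (auto simp: star_feasible_def)
      ultimately show "(if j \<le> r then max 0 (\<alpha> (r div N) - d (j div N)) else reconn (u (r div N)) (d (j div N))) \<le> ?g (j div N)"
        by (cases "j \<le> r"; cases "j div N = r div N") auto
    qed
    also have "\<dots> = real N * (\<Sum>i<n. ?g i)" using N by (rule sum_div_lessThan)
    also have "\<dots> \<le> real N * f"
      using feas dn[OF r] by (intro mult_left_mono) (auto simp: star_feasible_def)
    finally show ?thesis .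
  qed
  thus ?thesis using feas dn by (auto simp: star_feasible_def div_le_mono)
qed

lemma star_inequality:
  assumes feas: "star_feasible n \<alpha> d u f" and f: "0 \<le> f"
  shows "(\<Sum>r<n. \<alpha> r) \<le> 1.45 * f + 3.4035 * (\<Sum>r<n. d r)"
proof (cases "n = 0")
  case True thus ?thesis using f by simp
next
  case False
  \<comment> \<open>The copies form \<open>120\<close> blocks of size
    \<open>300 * n \<ge> 300\<close>; both sides of the inequality scale with
    \<open>N\<close>.\<close>
  define N :: nat where "N = 120 * 300"
  note dup = sum_div_lessThan[of N _ n]
  have N: "0 < N" by (simp add: N_def)
  have nN: "n * N = 120 * (300 * n)" by (simp add: N_def)
  have "(\<Sum>r<n*N. \<alpha> (r div N)) \<le> 1.45 * (real N * f) + 3.4035 * (\<Sum>r<n*N. d (r div N))"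
    unfolding nN using star_feasible_duplicate[OF feas, of N] False f
    by (intro star_scaled[where u = "\<lambda>r. u (r div N)"]) (auto simp: nN[symmetric] N_def mult.commute)
  hence "real N * (\<Sum>r<n. \<alpha> r) \<le> real N * (1.45 * f + 3.4035 * (\<Sum>r<n. d r))"
    unfolding dup[OF N] by (simp add: algebra_simps)
  thus ?thesis by (simp add: N_def)
qed

section \<open>Runs of the primal-dual algorithm\<close>

definition offer_base :: "('f \<Rightarrow> 'c \<Rightarrow> real) \<Rightarrow> ('c \<Rightarrow> 'f option) \<Rightarrow> real \<Rightarrow> 'c \<Rightarrow> real" where
  "offer_base c conn t j = (case conn j of None \<Rightarrow> t | Some i \<Rightarrow> c i j)"

lemma a2_offer_eq: "a2_offer c conn t i j = max (offer_base c conn t j - c i j) 0"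
  by (simp add: a2_offer_def offer_base_def split: option.split)

text \<open>\<open>\<alpha> j\<close> is the budget of \<open>j\<close> when it was first connected, \<open>ord j\<close> the number of that step, and
  \<open>R l j\<close> the amount from which \<open>j\<close> computed its offers when \<open>l\<close> was connected. The offer bound is
  maintained for open facilities too, where it holds because all offers to them vanish.\<close>

definition a2_inv :: "'c set \<Rightarrow> 'f set \<Rightarrow> ('f \<Rightarrow> real) \<Rightarrow> ('f \<Rightarrow> 'c \<Rightarrow> real)
    \<Rightarrow> ('c \<Rightarrow> real) \<Rightarrow> ('c \<Rightarrow> nat) \<Rightarrow> ('c \<Rightarrow> 'c \<Rightarrow> real) \<Rightarrow> nat \<Rightarrow> ('f,'c) a2_state \<Rightarrow> bool" where
  "a2_inv C F f c \<alpha> ord R N st \<longleftrightarrow> (case st of (t, Op, conn) \<Rightarrow>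
     let K = {j\<in>C. conn j \<noteq> None} in
     0 \<le> t \<and> Op \<subseteq> F \<and>
     (\<forall>j\<in>C. \<forall>i. conn j = Some i \<longrightarrow> i \<in> Op) \<and>
     (\<forall>j\<in>C - K. \<forall>i\<in>Op. t \<le> c i j) \<and>
     (\<forall>i\<in>F. a2_total_offer C c conn t i \<le> f i) \<and>
     (\<Sum>j\<in>K. \<alpha> j) = (\<Sum>i\<in>Op. f i) + (\<Sum>j\<in>K. offer_base c conn t j) \<and>
     (\<forall>l\<in>K. 0 \<le> \<alpha> l \<and> ord l < N) \<and>
     (\<forall>l\<in>K. \<forall>i\<in>F. (\<Sum>j\<in>C. max (R l j - c i j) 0) \<le> f i) \<and>
     (\<forall>l\<in>K. \<forall>j\<in>K. (ord l \<le> ord j \<longrightarrow> R l j = \<alpha> l) \<and>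
        (ord j \<le> ord l \<longrightarrow> offer_base c conn t j \<le> R l j)) \<and>
     (\<forall>l\<in>K. \<forall>j\<in>C - K. R l j = \<alpha> l) \<and>
     (\<forall>j\<in>K. \<forall>l\<in>K. \<forall>m\<in>K. \<forall>i\<in>F. ord j \<le> ord l \<longrightarrow> ord l \<le> ord m \<longrightarrow>
        sqrt (\<alpha> m) \<le> sqrt (R l j) + sqrt (c i j) + sqrt (c i m)))"

lemma a2_inv_init:
  assumes "\<forall>i\<in>F. 0 \<le> f i" "\<forall>i\<in>F. \<forall>j\<in>C. 0 \<le> c i j"
  shows "a2_inv C F f c \<alpha> ord R N (0, {}, \<lambda>_. None)"
  using assms by (simp add: a2_inv_def a2_total_offer_def a2_offer_def)

text \<open>Offers are continuous in time, so by the intermediate value theorem a total offer cannot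
  pass \<open>f i\<close> without an event. Offers to an open facility do not change, as unconnected
  cities remain at distance at least \<open>t'\<close>.\<close>

lemma a2_inv_advance:
  assumes inv: "a2_inv C F f c \<alpha> ord R N (t, Op, conn)"
    and fin: "finite C"
    and tt: "t \<le> t'"
    and ne: "\<And>s. t \<le> s \<Longrightarrow> s < t' \<Longrightarrow> a2_no_event C F f c Op conn s"
  shows "a2_inv C F f c \<alpha> ord R N (t', Op, conn)"
proof -
  define K where "K = {j\<in>C. conn j \<noteq> None}"
  have base: "offer_base c conn t' j = offer_base c conn t j" if "j \<in> K" for j
    using that by (auto simp: K_def offer_base_def)
  note I = inv[unfolded a2_inv_def Let_def prod.case, folded K_def]
  have U: "t' \<le> c i j" if "j \<in> C - K" "i \<in> Op" for i j
  proof (rule ccontr)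
    assume "\<not> t' \<le> c i j"
    moreover have "t \<le> c i j" using I that by blast
    ultimately have "a2_no_event C F f c Op conn (c i j)" using ne by simp
    thus False using that by (auto simp: a2_no_event_def K_def)
  qed
  have off: "a2_total_offer C c conn t' i \<le> f i" if i: "i \<in> F" for i
  proof (cases "i \<in> Op")
    case True
    have "a2_offer c conn t' i j = a2_offer c conn t i j" if j: "j \<in> C" for j
    proof (cases "j \<in> K")
      case False
      hence "t' \<le> c i j" "t \<le> c i j" "conn j = None" using U[of j i] True j tt by (auto simp: K_def)
      thus ?thesis by (simp add: a2_offer_def)
    qed (simp add: a2_offer_eq base)
    hence "a2_total_offer C c conn t' i = a2_total_offer C c conn t i"
      by (simp add: a2_total_offer_def)
    thus ?thesis using I i by simp
  next
    case False
    show ?thesis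
    proof (rule ccontr)
      assume *: "\<not> a2_total_offer C c conn t' i \<le> f i"
      have cont: "continuous_on {t..t'} (\<lambda>s. a2_total_offer C c conn s i)"
        unfolding a2_total_offer_def
      proof (rule continuous_on_sum)
        fix j
        show "continuous_on {t..t'} (\<lambda>s. a2_offer c conn s i j)"
          unfolding a2_offer_eq offer_base_def by (cases "conn j") (auto intro!: continuous_intros)
      qed
      have "a2_total_offer C c conn t i \<le> f i" using I i by simp
      then obtain s where s: "t \<le> s" "s \<le> t'" "a2_total_offer C c conn s i = f i"
        using IVT'[of "\<lambda>s. a2_total_offer C c conn s i" t "f i" t'] * tt cont by auto
      hence "s < t'" using * by (cases "s = t'") auto
      thus False using ne[OF s(1)] s(3) i False by (auto simp: a2_no_event_def)
    qed
  qed
  have "(\<Sum>j\<in>K. offer_base c conn t' j) = (\<Sum>j\<in>K. offer_base c conn t j)"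
    using base by (intro sum.cong) auto
  thus ?thesis
    unfolding a2_inv_def Let_def prod.case K_def[symmetric]
    using I tt U off base by auto
qed

text \<open>Covers both kinds of event: by \<open>pay\<close>, the amounts released by the cities
  finance exactly the newly opened facilities. A new city records the present budget, the step
  number and the present amounts of all cities.\<close>

lemma a2_inv_connect:
  assumes inv: "a2_inv C F f c \<alpha> ord R N (t, Op, conn)"
    and fin: "finite C" "finite F" and c: "\<forall>i\<in>F. \<forall>j\<in>C. 0 \<le> c i j"
    and sq: "squared_metric C F c"
    and Op: "Op \<subseteq> Op'" "Op' \<subseteq> F"
    and none: "\<And>j. j \<in> C \<Longrightarrow> conn' j = None \<Longrightarrow> conn j = None \<and> (\<forall>i\<in>Op'. t \<le> c i j)"
    and some: "\<And>j i. j \<in> C \<Longrightarrow> conn' j = Some i \<Longrightarrow> i \<in> Op' \<and> c i j \<le> offer_base c conn t j"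
    and pay: "(\<Sum>j\<in>{j\<in>C. conn' j \<noteq> None}. offer_base c conn t j - offer_base c conn' t j) = (\<Sum>i\<in>Op' - Op. f i)"
  shows "\<exists>\<alpha>' ord' R'. a2_inv C F f c \<alpha>' ord' R' (Suc N) (t, Op', conn')"
proof -
  define K where "K = {j\<in>C. conn j \<noteq> None}"
  define K' where "K' = {j\<in>C. conn' j \<noteq> None}"
  have KK: "K \<subseteq> K'" "K' \<subseteq> C" using none by (force simp: K_def K'_def)+
  note I = inv[unfolded a2_inv_def Let_def prod.case, folded K_def]
  define \<alpha>' where "\<alpha>' l = (if l \<in> K then \<alpha> l else t)" for l
  define ord' where "ord' l = (if l \<in> K then ord l else N)" for l
  define R' where "R' l j = (if l \<in> K then R l j else offer_base c conn t j)" for l j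
  have base: "offer_base c conn' t j \<le> offer_base c conn t j" if "j \<in> C" for j
    using none[OF that] some[OF that] by (cases "conn' j") (auto simp: offer_base_def)
  have baseU: "offer_base c conn t j = t" if "j \<in> C - K" for j
    using that by (auto simp: offer_base_def K_def)
  have off: "a2_total_offer C c conn' t i \<le> f i" if "i \<in> F" for i
  proof -
    have "a2_total_offer C c conn' t i \<le> a2_total_offer C c conn t i"
      unfolding a2_total_offer_def a2_offer_eq using base by (intro sum_mono max.mono diff_mono) auto
    thus ?thesis using I that by force
  qed
  have fK: "finite K'" using fin KK by (auto intro: finite_subset)
  have "(\<Sum>j\<in>K'. \<alpha>' j) = (\<Sum>j\<in>K. \<alpha> j) + (\<Sum>j\<in>K' - K. t)"
    using KK fK by (subst sum.subset_diff[of K K']) (auto simp: \<alpha>'_def)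
  also have "(\<Sum>j\<in>K' - K. t) = (\<Sum>j\<in>K' - K. offer_base c conn t j)"
    using baseU KK by (intro sum.cong) auto
  also have "(\<Sum>j\<in>K. \<alpha> j) + \<dots> = (\<Sum>i\<in>Op. f i) + (\<Sum>j\<in>K'. offer_base c conn t j)"
    using I KK fK by (subst sum.subset_diff[of K K' "offer_base c conn t"]) auto
  also have "\<dots> = (\<Sum>i\<in>Op. f i) + (\<Sum>i\<in>Op' - Op. f i) + (\<Sum>j\<in>K'. offer_base c conn' t j)"
    using pay unfolding K'_def[symmetric] by (simp add: sum_subtractf)
  also have "(\<Sum>i\<in>Op. f i) + (\<Sum>i\<in>Op' - Op. f i) = (\<Sum>i\<in>Op'. f i)"
    using Op fin by (subst sum.subset_diff[of Op Op']) (auto intro: finite_subset)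
  finally have cum_wt: "(\<Sum>j\<in>K'. \<alpha>' j) = (\<Sum>i\<in>Op'. f i) + (\<Sum>j\<in>K'. offer_base c conn' t j)" .
  \<comment> \<open>An unconnected \<open>m\<close> has distance at least \<open>t\<close> to every
    open facility, in particular to the one serving \<open>j\<close>; the squared metric inequality
    then goes through \<open>i\<close>.\<close>
  have new: "sqrt t \<le> sqrt (offer_base c conn t j) + sqrt (c i j) + sqrt (c i m)"
    if j: "j \<in> K'" and m: "m \<in> K' - K" and i: "i \<in> F" for i j m
  proof (cases "j \<in> K")
    case True
    then obtain i' where i': "conn j = Some i'" by (auto simp: K_def)
    have C: "j \<in> C" "m \<in> C - K" using True m KK by (auto simp: K_def)
    have "i' \<in> Op" using I i' C by blast
    hence "i' \<in> F" "t \<le> c i' m" using I C by blast+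
    hence "sqrt t \<le> sqrt (c i' m)" by simp
    also have "\<dots> \<le> sqrt (c i' j) + sqrt (c i j) + sqrt (c i m)"
      using sq C i \<open>i' \<in> F\<close> unfolding squared_metric_def by blast
    finally show ?thesis using i' by (simp add: offer_base_def)
  next
    case False
    hence "offer_base c conn t j = t" using baseU j KK by auto
    moreover have "0 \<le> c i j" "0 \<le> c i m" using c i j m KK by auto
    ultimately show ?thesis by simp
  qed
  have ordN: "ord l < N" if "l \<in> K" for l using I that by blast
  have "a2_inv C F f c \<alpha>' ord' R' (Suc N) (t, Op', conn')"
    unfolding a2_inv_def Let_def prod.case K'_def[symmetric]
  proof (intro conjI ballI impI allI)
    show "0 \<le> t" using I by blast
    show "Op' \<subseteq> F" by fact
    fix j i assume "j \<in> C" "conn' j = Some i"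
    thus "i \<in> Op'" using some by blast
  next
    fix j i assume "j \<in> C - K'" "i \<in> Op'"
    thus "t \<le> c i j" using none by (auto simp: K'_def)
  next
    fix i assume "i \<in> F" thus "a2_total_offer C c conn' t i \<le> f i" by (rule off)
  next
    show "(\<Sum>j\<in>K'. \<alpha>' j) = (\<Sum>i\<in>Op'. f i) + (\<Sum>j\<in>K'. offer_base c conn' t j)" by (rule cum_wt)
  next
    fix l assume l: "l \<in> K'"
    show "0 \<le> \<alpha>' l" using I by (auto simp: \<alpha>'_def)
    show "ord' l < Suc N" using ordN by (auto simp: ord'_def less_Suc_eq)
  next
    fix l i assume l: "l \<in> K'" and i: "i \<in> F"
    show "(\<Sum>j\<in>C. max (R' l j - c i j) 0) \<le> f i"
    proof (cases "l \<in> K")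
      case True thus ?thesis using I i by (simp add: R'_def)
    next
      case False
      thus ?thesis using I i by (simp add: R'_def a2_total_offer_def a2_offer_eq)
    qed
  next
    fix l j assume l: "l \<in> K'" and j: "j \<in> K'"
    show "R' l j = \<alpha>' l" if "ord' l \<le> ord' j"
    proof (cases "l \<in> K")
      case True
      show ?thesis
      proof (cases "j \<in> K")
        case jK: True
        thus ?thesis using True that I by (simp add: R'_def \<alpha>'_def ord'_def)
      next
        case jK: False
        thus ?thesis using True I j KK by (auto simp: R'_def \<alpha>'_def)
      qed
    next
      case False
      hence "j \<notin> K" using that ordN[of j] by (auto simp: ord'_def)
      thus ?thesis using False baseU[of j] j KK by (auto simp: R'_def \<alpha>'_def)
    qed
    show "offer_base c conn' t j \<le> R' l j" if "ord' j \<le> ord' l"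
    proof (cases "l \<in> K")
      case True
      hence jK: "j \<in> K" using that ordN[of l] by (auto simp: ord'_def split: if_splits)
      hence "offer_base c conn t j \<le> R l j" using I True that by (simp add: ord'_def)
      thus ?thesis using base[of j] j KK True by (auto simp: R'_def)
    next
      case False thus ?thesis using base[of j] j KK by (auto simp: R'_def)
    qed
  next
    fix l j assume lj: "l \<in> K'" "j \<in> C - K'"
    hence "j \<in> C - K" using KK by blast
    thus "R' l j = \<alpha>' l" using I baseU[of j] by (simp add: R'_def \<alpha>'_def)
  next
    fix j l m i assume *: "j \<in> K'" "l \<in> K'" "m \<in> K'" "i \<in> F" "ord' j \<le> ord' l" "ord' l \<le> ord' m"
    show "sqrt (\<alpha>' m) \<le> sqrt (R' l j) + sqrt (c i j) + sqrt (c i m)"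
    proof (cases "m \<in> K")
      case True
      hence "l \<in> K" using * ordN[of m] by (auto simp: ord'_def split: if_splits)
      moreover from this have "j \<in> K" using * ordN[of l] by (auto simp: ord'_def split: if_splits)
      ultimately show ?thesis using I True * by (simp add: \<alpha>'_def R'_def ord'_def)
    next
      case False
      \<comment> \<open>The amount of a connected city never increases, so the one recorded at
        \<open>l\<close> dominates the present one.\<close>
      have "offer_base c conn t j \<le> R' l j"
      proof (cases "l \<in> K")
        case True
        hence jK: "j \<in> K" using * ordN[of l] by (auto simp: ord'_def split: if_splits)
        thus ?thesis using I True * by (simp add: ord'_def R'_def)
      qed (simp add: R'_def)
      hence "sqrt (offer_base c conn t j) \<le> sqrt (R' l j)" by simp
      moreover have "sqrt t \<le> sqrt (offer_base c conn t j) + sqrt (c i j) + sqrt (c i m)"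
        using new[of j m i] False * by simp
      ultimately show ?thesis using False unfolding \<alpha>'_def by (simp del: real_sqrt_le_iff)
    qed
  qed
  thus ?thesis by blast
qed


lemma a2_inv_step:
  assumes inv: "a2_inv C F f c \<alpha> ord R N st" and step: "a2_step C F f c st st'"
    and fin: "finite C" "finite F" and c: "\<forall>i\<in>F. \<forall>j\<in>C. 0 \<le> c i j"
    and sq: "squared_metric C F c"
  shows "\<exists>\<alpha>' ord' R'. a2_inv C F f c \<alpha>' ord' R' (Suc N) st'"
proof -
  obtain t Op conn where st: "st = (t, Op, conn)" by (cases st)
  obtain t' Op' conn' where st': "st' = (t', Op', conn')" by (cases st')
  note S = step[unfolded a2_step_def st st' prod.case]
  have "a2_inv C F f c \<alpha> ord R N (t', Op, conn)"
    by (rule a2_inv_advance[OF inv[unfolded st] fin(1)]) (use S in auto)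
  note inv' = a2_inv_connect[OF this fin c sq]
  have OpF: "Op \<subseteq> F" and someOp: "\<And>j i. j \<in> C \<Longrightarrow> conn j = Some i \<Longrightarrow> i \<in> Op"
    and U: "\<And>j i. j \<in> C \<Longrightarrow> conn j = None \<Longrightarrow> i \<in> Op \<Longrightarrow> t' \<le> c i j"
    using \<open>a2_inv C F f c \<alpha> ord R N (t', Op, conn)\<close> by (auto simp: a2_inv_def Let_def)
  from S consider
    (a) j i where "j \<in> C" "i \<in> Op" "conn j = None" "t' = c i j" "Op' = Op" "conn' = conn(j := Some i)"
  | (b) i where "i \<in> F - Op" "a2_total_offer C c conn t' i = f i" "Op' = insert i Op"
      "conn' = (\<lambda>j. if j \<in> C \<and> a2_offer c conn t' i j > 0 then Some i else conn j)"
    by blast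
  thus ?thesis
  proof cases
    case a
    \<comment> \<open>The budget equals the distance at this moment, so no amount changes and
      nothing has to be paid.\<close>
    have "offer_base c conn t' j' - offer_base c conn' t' j' = 0" for j'
      using a by (simp add: offer_base_def)
    thus ?thesis unfolding st' using a OpF someOp U
      by (intro inv') (auto simp: offer_base_def split: if_splits)
  next
    case b
    \<comment> \<open>A city that moves to \<open>i\<close> lowers its amount by exactly its offer;
      all other offers are zero.\<close>
    have "(\<Sum>j\<in>{j\<in>C. conn' j \<noteq> None}. offer_base c conn t' j - offer_base c conn' t' j)
        = (\<Sum>j\<in>C. a2_offer c conn t' i j)"
    proof (rule sum.mono_neutral_cong_left)
      show "\<forall>j\<in>C - {j \<in> C. conn' j \<noteq> None}. a2_offer c conn t' i j = 0"
        using b(4) by (auto simp: a2_offer_eq max_def split: if_splits)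
      fix j assume "j \<in> {j \<in> C. conn' j \<noteq> None}"
      thus "offer_base c conn t' j - offer_base c conn' t' j = a2_offer c conn t' i j"
        by (auto simp: b(4) a2_offer_eq offer_base_def max_def split: if_splits)
    qed (use fin in auto)
    also have "\<dots> = (\<Sum>i\<in>Op' - Op. f i)"
    proof -
      have "Op' - Op = {i}" using b by auto
      thus ?thesis using b by (simp add: a2_total_offer_def)
    qed
    finally have pay: "(\<Sum>j\<in>{j\<in>C. conn' j \<noteq> None}. offer_base c conn t' j - offer_base c conn' t' j)
        = (\<Sum>i\<in>Op' - Op. f i)" .
    show ?thesis unfolding st'
    proof (rule inv'[OF _ _ _ _ pay])
      fix j assume j: "j \<in> C" "conn' j = None"
      hence "conn j = None" "\<not> a2_offer c conn t' i j > 0" using b(4) by (auto split: if_splits)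
      thus "conn j = None \<and> (\<forall>i\<in>Op'. t' \<le> c i j)"
        using U j b(3) by (auto simp: a2_offer_eq offer_base_def max_def split: if_splits)
    next
      fix j i' assume "j \<in> C" "conn' j = Some i'"
      thus "i' \<in> Op' \<and> c i' j \<le> offer_base c conn t' j"
        using someOp b(3) by (auto simp: b(4) a2_offer_eq offer_base_def max_def split: if_splits)
    qed (use b OpF in auto)
  qed
qed

lemma a2_inv_reachable:
  assumes "(a2_step C F f c)\<^sup>*\<^sup>* (0, {}, \<lambda>_. None) st"
    and "finite C" "finite F" "\<forall>i\<in>F. 0 \<le> f i" "\<forall>i\<in>F. \<forall>j\<in>C. 0 \<le> c i j" "squared_metric C F c"
  shows "\<exists>\<alpha> ord R N. a2_inv C F f c \<alpha> ord R N st"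
  using assms(1)
proof (induction rule: rtranclp_induct)
  case base
  show ?case using a2_inv_init[OF assms(4,5)] by blast
next
  case (step st st')
  thus ?case using a2_inv_step[OF _ step.hyps(2) assms(2,3,5,6)] by blast
qed

section \<open>From a run of the algorithm to a star\<close>

lemma star_of_a2_inv:
  fixes f :: "'f \<Rightarrow> real" and c :: "'f \<Rightarrow> 'c \<Rightarrow> real"
  assumes inv: "a2_inv C F f c \<alpha> ord R N (t, Op, conn)"
    and all: "\<forall>j\<in>C. conn j \<noteq> None"
    and fin: "finite C" and T: "T \<subseteq> C" and i: "i \<in> F"
    and f: "0 \<le> f i" and c: "\<forall>i\<in>F. \<forall>j\<in>C. 0 \<le> c i j"
  shows "(\<Sum>j\<in>T. \<alpha> j) \<le> 1.45 * f i + 3.4035 * (\<Sum>j\<in>T. c i j)"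
proof -
  have K: "{j\<in>C. conn j \<noteq> None} = C" using all by auto
  note I = inv[unfolded a2_inv_def Let_def prod.case K]
  have baseR: "0 \<le> offer_base c conn t j" if "j \<in> C" for j
    using I c that all by (fastforce simp: offer_base_def split: option.split)
  have R0: "0 \<le> R l j" if "l \<in> C" "j \<in> C" for l j
  proof (cases "ord l \<le> ord j")
    case True
    hence "R l j = \<alpha> l" "0 \<le> \<alpha> l" using I that by blast+
    thus ?thesis by simp
  next
    case False
    hence "offer_base c conn t j \<le> R l j" using I that by force
    thus ?thesis using baseR[OF that(2)] by linarith
  qed
  have finT: "finite T" using T fin by (rule finite_subset)
  define xs where "xs = rev (sort_key ord (SOME ys. set ys = T \<and> distinct ys))"
  have "set (SOME ys. set ys = T \<and> distinct ys) = T \<and> distinct (SOME ys. set ys = T \<and> distinct ys)"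
    using finite_distinct_list[OF finT] by (rule someI_ex)
  hence xs: "set xs = T" "distinct xs" by (auto simp: xs_def)
  define n where "n = length xs"
  define b where "b r = xs ! r" for r
  have bij: "bij_betw b {..<n} T"
    unfolding b_def n_def xs(1)[symmetric] using xs(2) by (intro bij_betw_nth) auto
  have bT: "b r \<in> C" if "r < n" for r using bij that T by (auto simp: bij_betw_def)
  have bord: "ord (b s) \<le> ord (b r)" if "r \<le> s" "s < n" for r s
  proof -
    have "sorted (map ord (rev xs))" by (simp add: xs_def)
    hence "sorted_wrt (\<ge>) (map ord xs)" by (simp add: rev_map[symmetric] sorted_wrt_rev)
    thus ?thesis using that unfolding b_def n_def
      by (cases "r = s") (auto simp: sorted_wrt_iff_nth_less)
  qed
  \<comment> \<open>\<open>(v r)\<^sup>2\<close> serves as \<open>u r\<close>. The running maximum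
    over the later cities is monotone by construction, as \<open>star_feasible\<close>
    demands.\<close>
  define v where "v r = max 0 (Max ((\<lambda>m. sqrt (\<alpha> (b m)) - sqrt (c i (b m))) ` {..r}))" for r
  have v0: "0 \<le> v r" for r by (simp add: v_def)
  have vmono: "v r \<le> v s" if "r \<le> s" for r s
    unfolding v_def using that by (intro max.mono Max_mono image_mono) auto
  have vR: "v r \<le> sqrt (R (b r) (b j)) + sqrt (c i (b j))" if r: "r < n" and j: "j < n" "r \<le> j" for r j
  proof -
    have "sqrt (\<alpha> (b m)) - sqrt (c i (b m)) \<le> sqrt (R (b r) (b j)) + sqrt (c i (b j))" if m: "m \<le> r" for m
    proof -
      have "ord (b j) \<le> ord (b r)" "ord (b r) \<le> ord (b m)" using bord m r j by auto
      hence "sqrt (\<alpha> (b m)) \<le> sqrt (R (b r) (b j)) + sqrt (c i (b j)) + sqrt (c i (b m))"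
        using I i bT m r j by (meson le_less_trans)
      thus ?thesis by simp
    qed
    moreover have "0 \<le> sqrt (R (b r) (b j)) + sqrt (c i (b j))"
      using R0 c i bT r j by simp
    ultimately show ?thesis unfolding v_def by (simp add: Max_le_iff)
  qed
  have rec: "reconn ((v r)\<^sup>2) (c i (b j)) \<le> max 0 (R (b r) (b j) - c i (b j))"
    if r: "r < n" and j: "j < n" "r \<le> j" for r j
  proof -
    have "(max 0 (v r - sqrt (c i (b j))))\<^sup>2 \<le> (sqrt (R (b r) (b j)))\<^sup>2"
      using vR[OF that] R0 bT r j by (intro power_mono) auto
    thus ?thesis using R0 bT r j v0[of r] unfolding reconn_def by (simp add: max.coboundedI2)
  qed
  have Req: "R (b r) (b j) = \<alpha> (b r)" if "r < n" "j \<le> r" for r j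
    using I bT bord[of j r] that by simp
  have "star_feasible n (\<lambda>r. \<alpha> (b r)) (\<lambda>r. c i (b r)) (\<lambda>r. (v r)\<^sup>2) (f i)"
    unfolding star_feasible_def
  proof (intro conjI allI impI)
    fix r assume r: "r < n"
    show "0 \<le> \<alpha> (b r)" using I bT[OF r] by blast
    show "0 \<le> c i (b r)" using c i bT[OF r] by blast
    show "0 \<le> (v r)\<^sup>2" by simp
    have "sqrt (\<alpha> (b r)) - sqrt (c i (b r)) \<le> Max ((\<lambda>m. sqrt (\<alpha> (b m)) - sqrt (c i (b m))) ` {..r})"
      by (intro Max_ge) auto
    also have "\<dots> \<le> v r" by (simp add: v_def)
    finally show "sqrt (\<alpha> (b r)) \<le> sqrt ((v r)\<^sup>2) + sqrt (c i (b r))" using v0[of r] by simp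
    show "reconn ((v r)\<^sup>2) (c i (b r)) \<le> max 0 (\<alpha> (b r) - c i (b r))"
      using rec[OF r r] Req[OF r] by simp
    have "(\<Sum>j<n. if j \<le> r then max 0 (\<alpha> (b r) - c i (b j)) else reconn ((v r)\<^sup>2) (c i (b j)))
        \<le> (\<Sum>j<n. max (R (b r) (b j) - c i (b j)) 0)"
    proof (rule sum_mono)
      fix j assume "j \<in> {..<n}"
      thus "(if j \<le> r then max 0 (\<alpha> (b r) - c i (b j)) else reconn ((v r)\<^sup>2) (c i (b j))) \<le> max (R (b r) (b j) - c i (b j)) 0"
        using rec[OF r, of j] Req[OF r, of j] by (auto simp: max.commute)
    qed
    also have "\<dots> = (\<Sum>j\<in>T. max (R (b r) j - c i j) 0)"
      by (rule sum.reindex_bij_betw[OF bij])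
    also have "\<dots> \<le> (\<Sum>j\<in>C. max (R (b r) j - c i j) 0)"
      using T fin by (intro sum_mono2) auto
    also have "\<dots> \<le> f i" using I bT[OF r] i by blast
    finally show "(\<Sum>j<n. if j \<le> r then max 0 (\<alpha> (b r) - c i (b j)) else reconn ((v r)\<^sup>2) (c i (b j))) \<le> f i" .
  next
    fix r s :: nat assume "r \<le> s"
    thus "(v r)\<^sup>2 \<le> (v s)\<^sup>2" using vmono v0 by (intro power_mono) auto
  qed
  from star_inequality[OF this f] show ?thesis
    using sum.reindex_bij_betw[OF bij, of \<alpha>] sum.reindex_bij_betw[OF bij, of "c i"] by simp
qed

section \<open>From single stars to whole solutions\<close>

definition conn_cost :: "('f \<Rightarrow> 'c \<Rightarrow> real) \<Rightarrow> 'c set \<Rightarrow> 'f set \<Rightarrow> real" where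
  "conn_cost c C S = (\<Sum>j\<in>C. Min ((\<lambda>i. c i j) ` S))"

lemma fl_cost_eq: "fl_cost f c C S = (\<Sum>i\<in>S. f i) + conn_cost c C S"
  by (simp add: fl_cost_def conn_cost_def)

lemma a2_bifactor:
  fixes f :: "'f \<Rightarrow> real" and c :: "'f \<Rightarrow> 'c \<Rightarrow> real"
  assumes out: "a2_output C F f c Op"
    and fin: "finite C" "finite F" and f: "\<forall>i\<in>F. 0 \<le> f i" and c: "\<forall>i\<in>F. \<forall>j\<in>C. 0 \<le> c i j"
    and sq: "squared_metric C F c"
    and F': "F' \<subseteq> F" "F' \<noteq> {}"
  shows "(\<Sum>i\<in>Op. f i) + conn_cost c C Op \<le> 1.45 * (\<Sum>i\<in>F'. f i) + 3.4035 * conn_cost c C F'"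
    and "Op \<subseteq> F" and "C \<noteq> {} \<Longrightarrow> Op \<noteq> {}"
proof -
  obtain t conn where run: "(a2_step C F f c)\<^sup>*\<^sup>* (0, {}, \<lambda>_. None) (t, Op, conn)"
    and "{j\<in>C. conn j = None} = {}"
    using out by (auto simp: a2_output_def)
  hence all: "\<forall>j\<in>C. conn j \<noteq> None" by auto
  obtain \<alpha> ord R N where inv: "a2_inv C F f c \<alpha> ord R N (t, Op, conn)"
    using a2_inv_reachable[OF run fin f c sq] by blast
  have K: "{j\<in>C. conn j \<noteq> None} = C" using all by auto
  note I = inv[unfolded a2_inv_def Let_def prod.case K]
  show OpF: "Op \<subseteq> F" using I by blast
  show "Op \<noteq> {}" if ne: "C \<noteq> {}"
  proof -
    obtain j i where "j \<in> C" "conn j = Some i" using all ne by fast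
    thus ?thesis using I by blast
  qed
  have finF': "finite F'" and finOp: "finite Op" using F' OpF fin by (auto intro: finite_subset)
  have "conn_cost c C Op \<le> (\<Sum>j\<in>C. offer_base c conn t j)"
    unfolding conn_cost_def
  proof (rule sum_mono)
    fix j assume j: "j \<in> C"
    then obtain i where i: "conn j = Some i" using all by blast
    hence "i \<in> Op" using I j by blast
    thus "Min ((\<lambda>i. c i j) ` Op) \<le> offer_base c conn t j" using i finOp by (simp add: offer_base_def)
  qed
  hence "(\<Sum>i\<in>Op. f i) + conn_cost c C Op \<le> (\<Sum>j\<in>C. \<alpha> j)" using I by simp
  also have "\<dots> \<le> 1.45 * (\<Sum>i\<in>F'. f i) + 3.4035 * conn_cost c C F'"
  proof -
    \<comment> \<open>\<open>g\<close> selects a nearest facility of \<open>F'\<close> for every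
      city and so partitions \<open>C\<close> into stars.\<close>
    have "\<exists>g. \<forall>j\<in>C. g j \<in> F' \<and> c (g j) j = Min ((\<lambda>i. c i j) ` F')"
    proof (rule bchoice, rule ballI)
      fix j
      have "Min ((\<lambda>i. c i j) ` F') \<in> (\<lambda>i. c i j) ` F'" using F' finF' by (intro Min_in) auto
      thus "\<exists>y. y \<in> F' \<and> c y j = Min ((\<lambda>i. c i j) ` F')" by auto
    qed
    then obtain g where g: "\<And>j. j \<in> C \<Longrightarrow> g j \<in> F'" "\<And>j. j \<in> C \<Longrightarrow> c (g j) j = Min ((\<lambda>i. c i j) ` F')"
      by blast
    have split: "(\<Sum>j\<in>C. h j) = (\<Sum>i\<in>F'. \<Sum>j\<in>{j\<in>C. g j = i}. h j)" for h :: "'c \<Rightarrow> real"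
      using g(1) by (intro sum.group[symmetric] fin finF') auto
    have "(\<Sum>j\<in>C. \<alpha> j) \<le> (\<Sum>i\<in>F'. 1.45 * f i + 3.4035 * (\<Sum>j\<in>{j\<in>C. g j = i}. c i j))"
      unfolding split[of \<alpha>] using F' f by (intro sum_mono star_of_a2_inv[OF inv all fin(1) _ _ _ c]) auto
    also have "\<dots> = 1.45 * (\<Sum>i\<in>F'. f i) + 3.4035 * (\<Sum>j\<in>C. c (g j) j)"
      unfolding split[of "\<lambda>j. c (g j) j"] by (simp add: sum.distrib sum_distrib_left)
    also have "(\<Sum>j\<in>C. c (g j) j) = conn_cost c C F'"
      unfolding conn_cost_def using g(2) by (intro sum.cong) auto
    finally show ?thesis .
  qed
  finally show "(\<Sum>i\<in>Op. f i) + conn_cost c C Op \<le> 1.45 * (\<Sum>i\<in>F'. f i) + 3.4035 * conn_cost c C F'" .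
qed

section \<open>Greedy augmentation\<close>

text \<open>For each city, the saving due to its nearest facility of \<open>F'\<close> is one of the
  nonnegative summands on the right, unless that facility is already open and there is nothing left
  to save.\<close>

lemma sum_gain_ge:
  fixes f :: "'f \<Rightarrow> real" and c :: "'f \<Rightarrow> 'c \<Rightarrow> real"
  assumes S: "finite S" "S \<noteq> {}" and F': "finite F'" "F' \<noteq> {}"
  shows "conn_cost c C S - conn_cost c C F' - (\<Sum>i\<in>F' - S. f i) \<le> (\<Sum>i\<in>F' - S. gain f c C S i)"
proof -
  let ?M = "\<lambda>S j. Min ((\<lambda>i. c i j) ` S)"
  have ins: "?M (insert i S) j = min (c i j) (?M S j)" for i j using S by simp
  have gain: "gain f c C S i = (\<Sum>j\<in>C. ?M S j - min (c i j) (?M S j)) - f i" if "i \<notin> S" for i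
    using that S ins by (simp add: gain_def fl_cost_def sum_subtractf del: Min_insert image_insert)
  have "?M S j - ?M F' j \<le> (\<Sum>i\<in>F' - S. ?M S j - min (c i j) (?M S j))" for j
  proof -
    have nn: "0 \<le> ?M S j - min (c i j) (?M S j)" for i by simp
    have "?M F' j \<in> (\<lambda>i. c i j) ` F'" using F' by (intro Min_in) auto
    then obtain i where i: "i \<in> F'" "?M F' j = c i j" by auto
    show ?thesis
    proof (cases "i \<in> S")
      case True
      hence "?M S j \<le> c i j" using S by simp
      moreover have "0 \<le> (\<Sum>i\<in>F' - S. ?M S j - min (c i j) (?M S j))" using nn by (rule sum_nonneg)
      ultimately show ?thesis using i by linarith
    next
      case False
      have "?M S j - min (c i j) (?M S j) \<le> (\<Sum>i\<in>F' - S. ?M S j - min (c i j) (?M S j))"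
        using False i F' nn by (intro member_le_sum) auto
      thus ?thesis using i by linarith
    qed
  qed
  hence "(\<Sum>j\<in>C. ?M S j - ?M F' j) \<le> (\<Sum>j\<in>C. \<Sum>i\<in>F' - S. ?M S j - min (c i j) (?M S j))"
    by (intro sum_mono)
  also have "\<dots> = (\<Sum>i\<in>F' - S. \<Sum>j\<in>C. ?M S j - min (c i j) (?M S j))" by (rule sum.swap)
  also have "\<dots> = (\<Sum>i\<in>F' - S. gain f c C S i + f i)" using gain by (intro sum.cong) auto
  finally show ?thesis by (simp add: conn_cost_def sum.distrib sum_subtractf)
qed

text \<open>Minimising the right-hand side over \<open>t \<ge> 1\<close> gives the usual logarithmic potential; keeping all
  \<open>t\<close> makes the induction linear.\<close>

lemma greedy_bound:
  fixes f :: "'f \<Rightarrow> real" and c :: "'f \<Rightarrow> 'c \<Rightarrow> real"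
  assumes run: "(greedy_step C F f c)\<^sup>*\<^sup>* S0 S" and final: "greedy_final C F f c S"
    and S0: "S0 \<subseteq> F" "S0 \<noteq> {}" and finF: "finite F" and f: "\<forall>i\<in>F. 0 \<le> f i"
    and F': "F' \<subseteq> F" "F' \<noteq> {}" and t: "1 \<le> t"
  shows "fl_cost f c C S \<le> (\<Sum>i\<in>S0. f i) + (conn_cost c C S0 - conn_cost c C F') / t
           + (\<Sum>i\<in>F'. f i) * ln t + conn_cost c C F'"
  using run S0 t
proof (induction arbitrary: t rule: converse_rtranclp_induct)
  case (base t)
  have fin: "finite S" "finite F'" using base F' finF by (auto intro: finite_subset)
  let ?D = "conn_cost c C S - conn_cost c C F'" and ?f = "\<Sum>i\<in>F'. f i"
  have "(\<Sum>i\<in>F' - S. gain f c C S i) \<le> 0"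
    using final F' by (intro sum_nonpos) (auto simp: greedy_final_def)
  moreover have "(\<Sum>i\<in>F' - S. f i) \<le> ?f" using fin F' f by (intro sum_mono2) auto
  ultimately have D: "?D \<le> ?f" using sum_gain_ge[OF fin(1) base(2) fin(2) F'(2), of c C f] by linarith
  have "?f \<ge> 0" using F' f by (intro sum_nonneg) auto
  have "ln (1 / t) \<le> 1 / t - 1" using base by (intro ln_le_minus_one) auto
  hence "1 - 1 / t \<le> ln t" using base by (simp add: ln_div)
  hence "?f * (1 - 1 / t) \<le> ?f * ln t" using \<open>?f \<ge> 0\<close> by (rule mult_left_mono)
  moreover have "?D * (1 - 1 / t) \<le> ?f * (1 - 1 / t)" using D base by (intro mult_right_mono) auto
  ultimately have "?D * (1 - 1 / t) \<le> ?f * ln t" by linarith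
  thus ?case by (simp add: fl_cost_eq algebra_simps diff_divide_distrib)
next
  case (step S0 S1 t)
  obtain u where u: "u \<in> F - S0" "0 < gain f c C S0 u" "S1 = insert u S0"
    and max: "\<And>i. i \<in> F - S0 \<Longrightarrow> 0 < gain f c C S0 i \<Longrightarrow> gain f c C S0 i * f u \<le> gain f c C S0 u * f i"
    using step.hyps(1) by (auto simp: greedy_step_def)
  have fin: "finite S0" "finite F'" using step.prems F' finF by (auto intro: finite_subset)
  define D where "D = conn_cost c C S0 - conn_cost c C F'"
  define fs where "fs = (\<Sum>i\<in>F'. f i)"
  define g where "g = gain f c C S0 u"
  have fs0: "0 \<le> fs" unfolding fs_def using F' f by (intro sum_nonneg) auto
  have fu: "0 \<le> f u" using u f by blast
  have g0: "0 < g" using u by (simp add: g_def)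
  \<comment> \<open>The best ratio is at least the average over \<open>F' - S0\<close>;
    cross-multiplied form of \<open>g / f u \<ge> (D - fs) / fs\<close>.\<close>
  have share: "(D - fs) * f u \<le> g * fs"
  proof -
    have le: "(\<Sum>i\<in>F' - S0. f i) \<le> fs" unfolding fs_def using fin F' f by (intro sum_mono2) auto
    have "(D - fs) * f u \<le> (\<Sum>i\<in>F' - S0. gain f c C S0 i) * f u"
      using sum_gain_ge[OF fin(1) step.prems(2) fin(2) F'(2), of c C f] fu le
      by (intro mult_right_mono) (auto simp: D_def)
    also have "\<dots> = (\<Sum>i\<in>F' - S0. gain f c C S0 i * f u)" by (rule sum_distrib_right)
    also have "\<dots> \<le> (\<Sum>i\<in>F' - S0. g * f i)"
    proof (rule sum_mono)
      fix i assume i: "i \<in> F' - S0"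
      show "gain f c C S0 i * f u \<le> g * f i"
      proof (cases "0 < gain f c C S0 i")
        case True thus ?thesis using max[of i] i F' by (auto simp: g_def)
      next
        case False
        hence "gain f c C S0 i * f u \<le> 0" using fu by (simp add: mult_nonpos_nonneg)
        also have "0 \<le> g * f i" using g0 f i F' by auto
        finally show ?thesis .
      qed
    qed
    also have "\<dots> = g * (\<Sum>i\<in>F' - S0. f i)" by (rule sum_distrib_left[symmetric])
    also have "\<dots> \<le> g * fs" using le g0 by (intro mult_left_mono) auto
    finally show ?thesis .
  qed
  have IH: "fl_cost f c C S \<le> (\<Sum>i\<in>S0. f i) + f u + (D - g - f u) / s + fs * ln s + conn_cost c C F'" if "1 \<le> s" for s
  proof -
    have "conn_cost c C S1 - conn_cost c C F' = D - g - f u"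
      using u fin by (simp add: D_def g_def gain_def fl_cost_eq)
    moreover have "(\<Sum>i\<in>S1. f i) = (\<Sum>i\<in>S0. f i) + f u" using u fin by simp
    ultimately show ?thesis
      using step.IH[of s] that u step.prems by (simp add: fs_def)
  qed
  have "fl_cost f c C S \<le> (\<Sum>i\<in>S0. f i) + D / t + fs * ln t + conn_cost c C F'"
  proof (cases "f u = 0")
    case True
    moreover have "(D - g) / t \<le> D / t" using g0 step.prems by (intro divide_right_mono) auto
    ultimately show ?thesis using IH[of t] step.prems by simp
  next
    case False
    hence fu: "0 < f u" using fu by simp
    show ?thesis
    proof (cases "D \<le> fs")
      case True
      \<comment> \<open>For \<open>D \<le> fs\<close> the expression
        \<open>D / t + fs * ln t\<close> is minimal over \<open>t \<ge> 1\<close> at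
        \<open>1\<close>, so the induction hypothesis is taken there.\<close>
      have "ln (1 / t) \<le> 1 / t - 1" using step.prems by (intro ln_le_minus_one) auto
      hence "1 - 1 / t \<le> ln t" using step.prems by (simp add: ln_div)
      hence "fs * (1 - 1 / t) \<le> fs * ln t" using fs0 by (rule mult_left_mono)
      moreover have "D * (1 - 1 / t) \<le> fs * (1 - 1 / t)" using True step.prems by (intro mult_right_mono) auto
      ultimately have "D * (1 - 1 / t) \<le> fs * ln t" by linarith
      thus ?thesis using IH[of 1] g0 by (simp add: algebra_simps)
    next
      case False
      have fsp: "0 < fs"
      proof (rule ccontr)
        assume "\<not> 0 < fs"
        hence "fs = 0" using fs0 by simp
        hence "D * f u \<le> 0" "0 < D" using share False by auto
        thus False using fu by (simp add: mult_le_0_iff)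
      qed
      \<comment> \<open>The minimiser of \<open>D / t + fs * ln t\<close>. At this point
        \<open>share\<close> says precisely that opening \<open>u\<close> does not raise the
        bound.\<close>
      define s where "s = D / fs"
      have s: "1 \<le> s" "0 < s" using False fsp by (auto simp: s_def)
      have "f u \<le> (g + f u) / s"
      proof -
        have "f u * D \<le> (g + f u) * fs" using share by (simp add: algebra_simps)
        thus ?thesis using False fsp by (simp add: s_def field_simps)
      qed
      moreover have "(D - g - f u) / s = D / s - (g + f u) / s" by (simp add: diff_divide_distrib add_divide_distrib)
      ultimately have 1: "f u + (D - g - f u) / s \<le> D / s" by linarith
      have "ln (s / t) \<le> s / t - 1" using s step.prems by (intro ln_le_minus_one) auto
      hence "ln s - ln t \<le> s / t - 1" using s step.prems by (simp add: ln_div)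
      hence "fs * (ln s - ln t) \<le> fs * (s / t - 1)" using fs0 by (rule mult_left_mono)
      also have "\<dots> = D / t - D / s" using fsp False by (simp add: s_def field_simps)
      finally have "D / s + fs * ln s \<le> D / t + fs * ln t" by (simp add: algebra_simps)
      thus ?thesis using IH[OF s(1)] 1 by linarith
    qed
  qed
  thus ?case by (simp add: D_def fs_def)
qed

section \<open>Combining the two phases\<close>

theorem theorem3:
  fixes C :: "'c set" and F :: "'f set" and f :: "'f \<Rightarrow> real" and c :: "'f \<Rightarrow> 'c \<Rightarrow> real"
    and \<delta> :: real and S :: "'f set"
  assumes "finite C" and "finite F" and "F \<noteq> {}"
    and "\<forall>i\<in>F. f i \<ge> 0" and "\<forall>i\<in>F. \<forall>j\<in>C. c i j \<ge> 0"
    and "squared_metric C F c"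
    and "\<delta> = 2.0543"
    and "a3_output \<delta> C F f c S"
  shows "\<forall>F'. F' \<subseteq> F \<and> F' \<noteq> {} \<longrightarrow> fl_cost f c C S \<le> 2.17 * fl_cost f c C F'"
proof (intro allI impI, elim conjE)
  fix F' assume F': "F' \<subseteq> F" "F' \<noteq> {}"
  obtain Op where out: "a2_output C F (\<lambda>i. \<delta> * f i) c Op"
    and run: "(greedy_step C F f c)\<^sup>*\<^sup>* Op S" and final: "greedy_final C F f c S"
    using assms(8) by (auto simp: a3_output_def)
  have \<delta>: "1 \<le> \<delta>" "0 < \<delta>" using assms(7) by auto
  have sf: "\<forall>i\<in>F. 0 \<le> \<delta> * f i" using assms(4) \<delta> by simp
  note bif = a2_bifactor[OF out assms(1,2) sf assms(5,6) F']
  define fs where "fs = (\<Sum>i\<in>F'. f i)"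
  define cs where "cs = conn_cost c C F'"
  have fs0: "0 \<le> fs" unfolding fs_def using F' assms(4) by (intro sum_nonneg) auto
  have finF': "finite F'" using F'(1) assms(2) by (rule finite_subset)
  have cs0: "0 \<le> cs" unfolding cs_def conn_cost_def
    using F' finF' assms(5) by (intro sum_nonneg) (auto simp: Min_ge_iff)
  have cost: "fl_cost f c C F' = fs + cs" by (simp add: fl_cost_eq fs_def cs_def)
  show "fl_cost f c C S \<le> 2.17 * fl_cost f c C F'"
  proof (cases "C = {}")
    case True
    \<comment> \<open>\<open>greedy_bound\<close> starts from a nonempty set, which is guaranteed
      only if there is a city. Without cities a facility never has positive gain.\<close>
    have "S = Op"
      using run
    proof (cases rule: converse_rtranclpE)
      case (step S1)
      then obtain i where "i \<in> F - Op" "0 < gain f c C Op i" by (auto simp: greedy_step_def)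
      moreover have "finite Op" using bif(2) assms(2) by (rule finite_subset)
      ultimately show ?thesis using assms(4) True by (force simp: gain_def fl_cost_def)
    qed simp
    moreover have "(\<Sum>i\<in>Op. \<delta> * f i) \<le> 1.45 * (\<delta> * fs)"
      using bif(1) True by (simp add: conn_cost_def fs_def sum_distrib_left)
    ultimately have "\<delta> * fl_cost f c C S \<le> \<delta> * (1.45 * fs)"
      using True by (simp add: fl_cost_def sum_distrib_left)
    hence "fl_cost f c C S \<le> 1.45 * fs" using \<delta> by simp
    thus ?thesis using fs0 cs0 unfolding cost by simp
  next
    case False
    have "ln \<delta> \<le> 0.72"
    proof -
      have "ln (2.0543 :: real) \<le> 0.72"
        using ln_approx_bounds[of "2.0543" 5] by (simp add: eval_nat_numeral)
      thus ?thesis unfolding assms(7) .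
    qed
    hence l: "fs * ln \<delta> \<le> fs * (0.72)" using fs0 by (rule mult_left_mono)
    have "\<delta> * (\<Sum>i\<in>Op. f i) + conn_cost c C Op \<le> 1.45 * (\<delta> * fs) + 3.4035 * cs"
      using bif(1) by (simp add: fs_def cs_def sum_distrib_left)
    hence "(\<delta> * (\<Sum>i\<in>Op. f i) + conn_cost c C Op) / \<delta> \<le> (1.45 * (\<delta> * fs) + 3.4035 * cs) / \<delta>"
      using \<delta> by (intro divide_right_mono) auto
    hence b: "(\<Sum>i\<in>Op. f i) + conn_cost c C Op / \<delta> \<le> 1.45 * fs + 3.4035 * cs / \<delta>"
      using \<delta> by (simp add: add_divide_distrib)
    \<comment> \<open>For \<open>t = \<delta>\<close>, opening cost plus
      \<open>conn_cost c C Op / \<delta>\<close> is the cost of \<open>Op\<close> in the scaled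
      instance divided by \<delta>.\<close>
    have "fl_cost f c C S \<le> (\<Sum>i\<in>Op. f i) + (conn_cost c C Op - cs) / \<delta> + fs * ln \<delta> + cs"
      using greedy_bound[OF run final bif(2) bif(3)[OF False] assms(2,4) F' \<delta>(1)] by (simp add: fs_def cs_def)
    hence "fl_cost f c C S \<le> 2.17 * fs + (2.4035 / \<delta> + 1) * cs"
      using b l by (simp add: diff_divide_distrib add_divide_distrib algebra_simps)
    also have "\<dots> \<le> 2.17 * fs + 2.17 * cs"
      unfolding assms(7) using cs0 by (intro add_left_mono mult_right_mono) auto
    finally show ?thesis unfolding cost by simp
  qed
qed

end
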